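(* Let $f$ be a real analytic LLD meromorphic function on $\mathbb{C}$ of finite order such that $f(1)=1$. There exists a unique family $(\Gamma^f_N)_{N\ge0}$ of functions satisfying: (1) $\Gamma^f_0(s)=f(s)^{-1}$; (2) $\Gamma^f_N(1)=1$ for all $N$; (3) $\Gamma^f_{N+1}(s+1)=\Gamma^f_N(s)^{-1}\,\Gamma^f_{N+1}(s)$ for $N\ge0$; (4) each $\Gamma^f_N$ is a meromorphic function of finite order; (5) each $\Gamma^f_N$ is LLD; (6) each $\Gamma^f_N$ is real analytic. If $f$ is CLD then all the $\Gamma^f_N$ are CLD.
   Context: $\mathbb{C}_+=\{\Re s>0\}$. LLD: no zeros nor poles in $\mathbb{C}_+$. CLD: zeros and poles contained in a closed cone contained in the closed half-plane $\{\Re s\le0\}$. Real analytic: $\overline{h(\bar s)}=h(s)$. Finite order: quotient of entire functions of finite order. *)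

theory Defs
  imports "HOL-Complex_Analysis.Complex_Analysis"
begin

text \<open>Zeros and poles of a meromorphic function on the complex plane
  (independent of the values at the singular points).\<close>
definition mero_zeros :: "(complex \<Rightarrow> complex) \<Rightarrow> complex set" where
  "mero_zeros h = {s. \<not> is_pole h s \<and> (h \<midarrow>s\<rightarrow> 0)}"

definition mero_poles :: "(complex \<Rightarrow> complex) \<Rightarrow> complex set" where
  "mero_poles h = {s. is_pole h s}"

definition LLD :: "(complex \<Rightarrow> complex) \<Rightarrow> bool" where
  "LLD h \<longleftrightarrow> (\<forall>s \<in> mero_zeros h \<union> mero_poles h. Re s \<le> 0)"

text \<open>CLD: zeros and poles contained in a closed cone (vertex 0, symmetric about the
  negative real axis, half-aperture < pi/2) inside the closed half-plane Re s \<le> 0.\<close>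
definition CLD :: "(complex \<Rightarrow> complex) \<Rightarrow> bool" where
  "CLD h \<longleftrightarrow> (\<exists>c>0. \<forall>s \<in> mero_zeros h \<union> mero_poles h. c * \<bar>Im s\<bar> \<le> - Re s)"

definition real_analytic_fun :: "(complex \<Rightarrow> complex) \<Rightarrow> bool" where
  "real_analytic_fun h \<longleftrightarrow> (\<forall>s. cnj (h (cnj s)) = h s)"

definition entire_finite_order :: "(complex \<Rightarrow> complex) \<Rightarrow> bool" where
  "entire_finite_order g \<longleftrightarrow> g holomorphic_on UNIV \<and>
     (\<exists>\<rho> C. \<forall>s. norm (g s) \<le> C * exp (norm s powr \<rho>))"

text \<open>Meromorphic function of finite order: quotient of entire functions of finite order
  (equality as meromorphic functions, i.e. outside a discrete set).\<close>
definition mero_finite_order :: "(complex \<Rightarrow> complex) \<Rightarrow> bool" where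
  "mero_finite_order h \<longleftrightarrow> h meromorphic_on UNIV \<and>
     (\<exists>g k. entire_finite_order g \<and> entire_finite_order k \<and> (\<exists>z. k z \<noteq> 0) \<and>
        (\<forall>\<^sub>\<approx>s. h s = g s / k s))"

text \<open>The defining properties (1)-(6) of the family Gamma^f_N, functions being represented by
  their canonical (nicely meromorphic) representatives.\<close>
definition gamma_family :: "(complex \<Rightarrow> complex) \<Rightarrow> (nat \<Rightarrow> complex \<Rightarrow> complex) \<Rightarrow> bool" where
  "gamma_family f \<Gamma> \<longleftrightarrow>
     (\<forall>\<^sub>\<approx>s. \<Gamma> 0 s = inverse (f s)) \<and>
     (\<forall>N. \<Gamma> N 1 = 1) \<and>
     (\<forall>N. \<forall>\<^sub>\<approx>s. \<Gamma> (Suc N) (s + 1) = inverse (\<Gamma> N s) * \<Gamma> (Suc N) s) \<and>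
     (\<forall>N. \<Gamma> N nicely_meromorphic_on UNIV \<and> mero_finite_order (\<Gamma> N)) \<and>
     (\<forall>N. LLD (\<Gamma> N)) \<and>
     (\<forall>N. real_analytic_fun (\<Gamma> N))"

end

theory Submission
  imports Defs
begin

text \<open>
  Write \<open>f = a / b\<close> with entire \<open>a, b\<close> of finite order which are real and zero-free on \<open>Re s > 0\<close>;
  common zeros in the right half-plane are removed with a canonical product. It then suffices to
  solve \<open>G s = a s * G (s + 1)\<close> within this class of entire functions, since
  \<open>\<Gamma> (Suc N)\<close> is the quotient of the solutions for the numerator and the denominator of \<open>\<Gamma> N\<close>.
  On \<open>Re s > 0\<close> a logarithm \<open>L\<close> of \<open>a\<close> grows polynomially (Borel--Caratheodory on large discs), so
  a high derivative of \<open>L\<close> decays and its difference equation is solved by summing over shifts;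
  integrating back and exponentiating gives \<open>G\<close> on \<open>Re s > 1\<close>. The functional equation extends \<open>G\<close> to
  an entire function, and the same formula bounds its order.

  For uniqueness, the quotient of two solutions is 1-periodic without zeros and poles on
  \<open>Re s > 0\<close>, hence everywhere. It is of finite order, hence the exponential of a polynomial, and
  periodicity together with reality and the value at 1 makes it constant.
\<close>

section \<open>Entire functions of finite order\<close>

text \<open>Zeros on the imaginary axis are allowed, so a logarithm of \<open>a\<close> is not
  controlled as Re s tends to 0: its growth is bounded on Re s >= 1/2 only, and the Cauchy discs of
  radius Re s / 2 then force Re s > 1. The derivative bound (1 + |s|)^n / (Re s)^(n+2) does not
  decay along vertical lines, but it does along s, s + 1, s + 2, ..., which is what summation over
  shifts needs. Numerators and denominators are treated separately because continuation to the left
  multiplies values of the coefficient. For an entire coefficient this is about |s| factors, each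
  bounded by the exponential of a polynomial in |s|, so the exponent rises by one only; poles would
  destroy the bound. The other obstacle is division. Both the removal of zeros and uniqueness lead
  to an entire q with q b = a, where a and b have finite order, and 1 / b is unbounded near the
  zeros of b. A Blaschke product removes these zeros in a disc, and Borel-Caratheodory bounds the
  remaining zero-free factor from below.\<close>

lemma entire_finite_orderI:
  assumes "g holomorphic_on UNIV" and "\<And>s. norm (g s) \<le> exp (A * (1 + norm s) ^ n)"
  shows "entire_finite_order g"
proof -
  \<comment> \<open>Beyond \<open>x0\<close> one has \<open>1 + norm s <= 2 * norm s\<close>, and
    \<open>norm s\<close> dominates the coefficient, which is absorbed at the price of one more
    power. Inside, the constant \<open>C\<close> suffices.\<close>
  define x0 where "x0 = max 1 (\<bar>A\<bar> * 2 ^ n)"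
  define C where "C = exp (\<bar>A\<bar> * (1 + x0) ^ n)"
  have C: "C \<ge> 1" by (simp add: C_def x0_def)
  have "norm (g s) \<le> C * exp (norm s powr real (Suc n))" for s
  proof (cases "norm s \<le> x0")
    case True
    have "norm (g s) \<le> exp (A * (1 + norm s) ^ n)" by (rule assms)
    also have "\<dots> \<le> exp (\<bar>A\<bar> * (1 + norm s) ^ n)"
      by (simp add: mult_right_mono)
    also have "\<dots> \<le> C"
      unfolding C_def using True by (simp add: mult_left_mono power_mono)
    also have "\<dots> \<le> C * exp (norm s powr real (Suc n))"
      using C by simp
    finally show ?thesis .
  next
    case False
    hence s: "norm s \<ge> 1" "norm s \<ge> \<bar>A\<bar> * 2 ^ n" by (auto simp: x0_def)
    have "norm (g s) \<le> exp (A * (1 + norm s) ^ n)" by (rule assms)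
    also have "\<dots> \<le> exp (\<bar>A\<bar> * (1 + norm s) ^ n)"
      by (simp add: mult_right_mono)
    also have "\<dots> \<le> exp (\<bar>A\<bar> * (2 * norm s) ^ n)"
      using s by (intro exp_le_cancel_iff[THEN iffD2] mult_left_mono power_mono) auto
    also have "\<bar>A\<bar> * (2 * norm s) ^ n = (\<bar>A\<bar> * 2 ^ n) * norm s ^ n"
      by (simp add: power_mult_distrib)
    also have "exp \<dots> \<le> exp (norm s * norm s ^ n)"
      using s by (intro exp_le_cancel_iff[THEN iffD2] mult_right_mono) auto
    also have "norm s * norm s ^ n = norm s powr real (Suc n)"
      using s by (subst powr_realpow) auto
    also have "exp \<dots> \<le> C * exp \<dots>"
      using C by simp
    finally show ?thesis .
  qed
  thus ?thesis using assms(1) by (auto simp: entire_finite_order_def)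
qed

text \<open>The normal form for all growth estimates: as \<open>1 + norm s >= 1\<close> and
  exponents are natural, bounds merge by raising coefficient and exponent. The unit disc is treated
  by compactness, because there a larger exponent makes \<open>norm s powr\<close> smaller.\<close>

lemma entire_finite_orderE:
  assumes "entire_finite_order g"
  obtains A n where "A \<ge> 0" "\<And>s. norm (g s) \<le> exp (A * (1 + norm s) ^ n)" "g holomorphic_on UNIV"
proof -
  from assms obtain \<rho> C where hol: "g holomorphic_on UNIV"
    and b: "\<And>s. norm (g s) \<le> C * exp (norm s powr \<rho>)"
    by (auto simp: entire_finite_order_def)
  have "compact (g ` cball 0 1)"
    using hol by (intro compact_continuous_image holomorphic_on_imp_continuous_on)
       (auto intro: holomorphic_on_subset)
  then obtain M where M: "\<And>s. s \<in> cball 0 1 \<Longrightarrow> norm (g s) \<le> M"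
    by (meson bounded_iff compact_imp_bounded imageI)
  define n where "n = nat \<lceil>\<rho>\<rceil>"
  have n: "\<rho> \<le> real n" unfolding n_def by linarith
  define K where "K = max 1 (max M C)"
  have K: "K \<ge> 1" "K \<ge> M" "K \<ge> C" by (auto simp: K_def)
  show ?thesis
  proof (rule that[of "ln K + 1" n])
    show "0 \<le> ln K + 1" using K by simp
    fix s :: complex
    have p1: "1 \<le> (1 + norm s) ^ n" by simp
    have le: "K * exp ((1 + norm s) ^ n) \<le> exp ((ln K + 1) * (1 + norm s) ^ n)"
    proof -
      have "ln K * 1 \<le> ln K * (1 + norm s) ^ n"
        using K p1 by (intro mult_left_mono) auto
      hence "exp (ln K + (1 + norm s) ^ n) \<le> exp ((ln K + 1) * (1 + norm s) ^ n)"
        by (simp add: algebra_simps)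
      thus ?thesis using K by (simp add: exp_add)
    qed
    have "norm (g s) \<le> K * exp ((1 + norm s) ^ n)"
    proof (cases "norm s \<le> 1")
      case True
      hence "norm (g s) \<le> K * 1" using M[of s] K by auto
      also have "\<dots> \<le> K * exp ((1 + norm s) ^ n)"
        using K by (intro mult_left_mono) auto
      finally show ?thesis .
    next
      case False
      have "norm (g s) \<le> C * exp (norm s powr \<rho>)" by (rule b)
      also have "\<dots> \<le> K * exp (norm s powr \<rho>)"
        using K by (intro mult_right_mono) auto
      also have "norm s powr \<rho> \<le> norm s powr real n"
        using False n by (intro powr_mono) auto
      also have "norm s powr real n = norm s ^ n"
        using False by (subst powr_realpow) auto
      also have "norm s ^ n \<le> (1 + norm s) ^ n"
        by (intro power_mono) auto
      finally show ?thesis using K by simp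
    qed
    thus "norm (g s) \<le> exp ((ln K + 1) * (1 + norm s) ^ n)" using le by linarith
  qed fact
qed

lemma exp_poly_growth_mono:
  fixes A B x :: real
  assumes "0 \<le> A" "A \<le> B" "n \<le> m" "0 \<le> x"
  shows "A * (1 + x) ^ n \<le> B * (1 + x) ^ m"
  using assms by (intro mult_mono power_increasing) auto

lemma entire_finite_order_mult:
  assumes "entire_finite_order g" "entire_finite_order h"
  shows "entire_finite_order (\<lambda>s. g s * h s)"
proof -
  obtain A n where g: "A \<ge> 0" "\<And>s. norm (g s) \<le> exp (A * (1 + norm s) ^ n)" "g holomorphic_on UNIV"
    using assms(1) by (rule entire_finite_orderE) blast
  obtain B m where h: "B \<ge> 0" "\<And>s. norm (h s) \<le> exp (B * (1 + norm s) ^ m)" "h holomorphic_on UNIV"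
    using assms(2) by (rule entire_finite_orderE) blast
  show ?thesis
  proof (rule entire_finite_orderI[where A = "A + B" and n = "max n m"])
    fix s
    have "norm (g s * h s) \<le> exp (A * (1 + norm s) ^ n) * exp (B * (1 + norm s) ^ m)"
      unfolding norm_mult by (intro mult_mono g h) auto
    also have "\<dots> = exp (A * (1 + norm s) ^ n + B * (1 + norm s) ^ m)"
      by (simp add: exp_add)
    also have "\<dots> \<le> exp (A * (1 + norm s) ^ max n m + B * (1 + norm s) ^ max n m)"
      using g(1) h(1) by (intro exp_le_cancel_iff[THEN iffD2] add_mono exp_poly_growth_mono) auto
    finally show "norm (g s * h s) \<le> exp ((A + B) * (1 + norm s) ^ max n m)"
      by (simp add: algebra_simps)
  qed (intro holomorphic_intros g h)
qed

lemma entire_finite_order_const [simp]: "entire_finite_order (\<lambda>_. c)"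
proof (rule entire_finite_orderI[where A = "norm c" and n = 0])
  show "norm c \<le> exp (norm c * (1 + norm s) ^ 0)" for s :: complex
    using exp_ge_add_one_self[of "norm c"] by (simp del: exp_ge_add_one_self)
qed auto

lemma entire_finite_order_shift:
  assumes "entire_finite_order g"
  shows "entire_finite_order (\<lambda>s. g (s + p))"
proof -
  obtain A n where g: "A \<ge> 0" "\<And>s. norm (g s) \<le> exp (A * (1 + norm s) ^ n)" "g holomorphic_on UNIV"
    using assms(1) by (rule entire_finite_orderE) blast
  show ?thesis
  proof (rule entire_finite_orderI[where A = "A * (1 + norm p) ^ n" and n = n])
    fix s
    have "1 + norm (s + p) \<le> 1 + (norm s + norm p)"
      using norm_triangle_ineq[of s p] by simp
    also have "\<dots> \<le> (1 + norm p) * (1 + norm s)" by (simp add: algebra_simps)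
    finally have "A * (1 + norm (s + p)) ^ n \<le> A * ((1 + norm p) * (1 + norm s)) ^ n"
      using g(1) by (intro mult_left_mono power_mono) auto
    also have "\<dots> = A * (1 + norm p) ^ n * (1 + norm s) ^ n"
      by (simp add: power_mult_distrib)
    finally show "norm (g (s + p)) \<le> exp (A * (1 + norm p) ^ n * (1 + norm s) ^ n)"
      using g(2)[of "s + p"] by (meson exp_le_cancel_iff order_trans)
  next
    show "(\<lambda>s. g (s + p)) holomorphic_on UNIV"
      by (intro holomorphic_on_compose_gen[OF _ g(3), unfolded o_def] holomorphic_intros) auto
  qed
qed

lemma holomorphic_on_cnj_conj:
  assumes "g holomorphic_on A" "open A" "\<And>s. s \<in> A \<Longrightarrow> cnj s \<in> A"
  shows "(\<lambda>s. cnj (g (cnj s))) holomorphic_on A"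
proof -
  have "cnj ` A = A" using assms(3) by (force simp: image_iff intro: exI[of _ "cnj _"])
  thus ?thesis
    using holomorphic_on_compose_cnj_cnj[of g A] assms by (simp add: o_def)
qed

lemma entire_finite_order_cnj_conj:
  assumes "entire_finite_order g"
  shows "entire_finite_order (\<lambda>s. cnj (g (cnj s)))"
proof -
  obtain A n where g: "A \<ge> 0" "\<And>s. norm (g s) \<le> exp (A * (1 + norm s) ^ n)" "g holomorphic_on UNIV"
    using assms(1) by (rule entire_finite_orderE) blast
  show ?thesis
    by (rule entire_finite_orderI[where A = A and n = n])
       (use g(2)[of "cnj _"] g(3) in \<open>auto intro!: holomorphic_on_cnj_conj\<close>)
qed

section \<open>The Borel-Caratheodory inequality and division by finitely many zeros\<close>

lemma norm_diff_less_norm_add_cnj: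
  assumes "Re u > 0" "Re v > 0"
  shows "norm (u - v) < norm (u + cnj v)"
proof -
  have "(norm (u + cnj v))\<^sup>2 - (norm (u - v))\<^sup>2 = 4 * (Re u * Re v)"
    unfolding cmod_power2 by (simp add: power2_eq_square algebra_simps)
  moreover have "Re u * Re v > 0" using assms by simp
  ultimately have "(norm (u - v))\<^sup>2 < (norm (u + cnj v))\<^sup>2" by linarith
  thus ?thesis by (rule power_less_imp_less_base) simp
qed

text \<open>The second bound, in terms of the value at \<open>z\<close> instead of the centre, is what allows a
  bound to be transported from an off-centre point to the centre of a large disc.\<close>
lemma borel_caratheodory:
  assumes hol: "L holomorphic_on ball c R" and M: "\<And>z. z \<in> ball c R \<Longrightarrow> Re (L z) < M"
    and z: "z \<in> ball c R"
  defines "t \<equiv> dist c z / R"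
  shows "(1 - t) * norm (L z - L c) \<le> 2 * t * (M - Re (L c))"
    and "(1 - t) * norm (L z - L c) \<le> 2 * t * (M - Re (L z))"
proof -
  have R: "R > 0" using z by (metis ball_eq_empty equals0D not_le)
  have c: "c \<in> ball c R" using R by simp
  \<comment> \<open>With \<open>u = M - L x\<close> and \<open>v = M - L c\<close> this is the
    Moebius map \<open>(u - v) / (u + cnj v)\<close> from the right half-plane to the unit disc. It
    sends \<open>L c\<close> to 0, so the Schwarz lemma applies.\<close>
  define \<phi> where "\<phi> = (\<lambda>w. (L c - L (c + of_real R * w)) / (2 * of_real M - L (c + of_real R * w) - cnj (L c)))"
  have inball: "c + of_real R * w \<in> ball c R" if "norm w < 1" for w
    using that R by (simp add: dist_norm norm_mult)
  have lt: "norm (L c - L x) < norm (2 * of_real M - L x - cnj (L c))" if "x \<in> ball c R" for x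
    using norm_diff_less_norm_add_cnj[of "of_real M - L x" "of_real M - L c"] M[OF that] M[OF c]
    by (simp add: algebra_simps)
  have nz: "2 * of_real M - L x - cnj (L c) \<noteq> 0" if "x \<in> ball c R" for x
    using lt[OF that] by (metis norm_not_less_zero norm_zero)
  have hol': "(\<lambda>w. L (c + of_real R * w)) holomorphic_on ball 0 1"
    by (intro holomorphic_on_compose_gen[OF _ hol, unfolded o_def] holomorphic_intros)
       (use inball in auto)
  have "norm (\<phi> \<xi>) \<le> norm \<xi>" if "norm \<xi> < 1" for \<xi>
  proof (rule Schwarz_Lemma(1))
    show "\<phi> holomorphic_on ball 0 1"
      unfolding \<phi>_def by (intro holomorphic_intros hol') (use nz inball in auto)
    show "norm (\<phi> w) < 1" if "norm w < 1" for w
      unfolding \<phi>_def norm_divide using lt[OF inball[OF that]]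
      by (smt (verit, best) divide_less_eq_1_pos norm_ge_zero)
  qed (use that in \<open>auto simp: \<phi>_def\<close>)
  from this[of "(z - c) / of_real R"]
  have "norm (\<phi> ((z - c) / of_real R)) \<le> t"
    using z R by (simp add: norm_divide dist_norm norm_minus_commute t_def)
  moreover have "c + of_real R * ((z - c) / of_real R) = z" using R by simp
  ultimately have le: "norm (L z - L c) \<le> t * norm (2 * of_real M - L z - cnj (L c))"
    using nz[OF z] unfolding \<phi>_def by (simp add: norm_divide field_simps norm_minus_commute)
  have t: "t \<ge> 0" using R by (simp add: t_def)
  have "norm (2 * of_real M - L z - cnj (L c)) = norm ((L c - L z) + of_real (2 * (M - Re (L c))))"
    by (rule arg_cong[of _ _ norm]) (simp add: complex_eq_iff)
  also have "\<dots> \<le> norm (L c - L z) + norm (of_real (2 * (M - Re (L c))) :: complex)"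
    by (rule norm_triangle_ineq)
  also have "\<dots> = norm (L z - L c) + 2 * (M - Re (L c))"
    using M[OF c] by (simp add: norm_minus_commute del: of_real_mult of_real_diff)
  finally have "norm (L z - L c) \<le> t * (norm (L z - L c) + 2 * (M - Re (L c)))"
    using le t by (meson mult_left_mono order_trans)
  thus "(1 - t) * norm (L z - L c) \<le> 2 * t * (M - Re (L c))"
    by (simp add: algebra_simps)
  \<comment> \<open>Conjugating the same number exchanges the roles of \<open>L z\<close> and
    \<open>L c\<close>: now \<open>M - Re (L z)\<close> splits off.\<close>
  have "norm (2 * of_real M - L z - cnj (L c)) = norm (cnj ((L z - L c) + of_real (2 * (M - Re (L z)))))"
    by (rule arg_cong[of _ _ norm]) (simp add: complex_eq_iff)
  also have "\<dots> \<le> norm (L z - L c) + norm (of_real (2 * (M - Re (L z))) :: complex)"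
    unfolding complex_mod_cnj by (rule norm_triangle_ineq)
  also have "\<dots> = norm (L z - L c) + 2 * (M - Re (L z))"
    using M[OF z] by (simp del: of_real_mult of_real_diff)
  finally have "norm (L z - L c) \<le> t * (norm (L z - L c) + 2 * (M - Re (L z)))"
    using le t by (meson mult_left_mono order_trans)
  thus "(1 - t) * norm (L z - L c) \<le> 2 * t * (M - Re (L z))"
    by (simp add: algebra_simps)
qed

text \<open>The quotient by the polynomial has removable singularities only: near each
  \<open>w\<close> in \<open>Z\<close> the local factor \<open>zor_poly g w\<close> shows the limit
  to be finite and nonzero. The point \<open>p\<close> excludes \<open>g = 0\<close>, which has no
  orders of vanishing.\<close>

lemma holomorphic_divide_zeros:
  assumes g: "g holomorphic_on UNIV" "g p \<noteq> 0" and Z: "finite Z" "\<And>w. w \<in> Z \<Longrightarrow> g w = 0"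
  obtains c where "c holomorphic_on UNIV"
    "\<And>z. g z = c z * (\<Prod>w\<in>Z. (z - w) ^ nat (zorder g w))" "\<And>w. w \<in> Z \<Longrightarrow> c w \<noteq> 0"
    "\<And>w. w \<in> Z \<Longrightarrow> zorder g w > 0"
proof -
  define P where "P = (\<lambda>Y z. \<Prod>w\<in>Y. (z - w) ^ nat (zorder g w))"
  have P_hol: "P Y holomorphic_on UNIV" for Y
    unfolding P_def by (intro holomorphic_intros)
  have P_nz: "P Y z \<noteq> 0" if "z \<notin> Y" "Y \<subseteq> Z" for z Y
    using that finite_subset[OF _ Z(1)] by (auto simp: P_def)
  define c where "c = remove_sings (\<lambda>z. g z / P Z z)"
  have ana: "(\<lambda>z. g z / P Z z) analytic_on {z}" if "z \<notin> Z" for z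
    by (intro analytic_intros holomorphic_on_imp_analytic_at[OF g(1)] holomorphic_on_imp_analytic_at[OF P_hol])
       (use that P_nz in auto)
  have at_Z: "zorder g w > 0 \<and> c analytic_on {w} \<and> c w \<noteq> 0" if w: "w \<in> Z" for w
  proof -
    define h where "h = zor_poly g w"
    have "\<exists>w\<in>UNIV. g w \<noteq> 0" using g(2) by blast
    from zorder_exist_zero[OF g(1) open_UNIV connected_UNIV UNIV_I this, of w] Z(2)[OF w]
    obtain r where pos: "zorder g w > 0" and r: "r > 0" "h holomorphic_on cball w r"
      "\<And>z. z \<in> cball w r \<Longrightarrow> g z = h z * (z - w) ^ nat (zorder g w) \<and> h z \<noteq> 0"
      unfolding h_def by metis
    have hana: "(\<lambda>z. h z / P (Z - {w}) z) analytic_on {w}"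
      by (intro analytic_intros holomorphic_on_imp_analytic_at[OF P_hol]
                holomorphic_on_imp_analytic_at[OF holomorphic_on_subset[OF r(2)], of "ball w r"])
         (use r(1) P_nz[of w "Z - {w}"] in auto)
    have "eventually (\<lambda>z. z \<in> ball w r - {w}) (at w)"
      using r by (intro eventually_at_in_open) auto
    hence ev: "eventually (\<lambda>z. g z / P Z z = h z / P (Z - {w}) z) (at w)"
    proof eventually_elim
      case (elim z)
      have "P Z z = (z - w) ^ nat (zorder g w) * P (Z - {w}) z"
        unfolding P_def using Z(1) w by (subst prod.remove[of _ w]) auto
      thus ?case using r(3)[of z] elim by auto
    qed
    have "isolated_singularity_at (\<lambda>z. h z / P (Z - {w}) z) w"
      using hana isolated_singularity_at_analytic by blast
    hence iso: "isolated_singularity_at (\<lambda>z. g z / P Z z) w"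
      using isolated_singularity_at_cong[OF ev refl] by simp
    have "(\<lambda>z. h z / P (Z - {w}) z) \<midarrow>w\<rightarrow> h w / P (Z - {w}) w"
      using isContD[OF analytic_at_imp_isCont[OF hana]] .
    hence lim: "(\<lambda>z. g z / P Z z) \<midarrow>w\<rightarrow> h w / P (Z - {w}) w"
      using tendsto_cong[OF ev] by simp
    have "c w = h w / P (Z - {w}) w"
      unfolding c_def using lim by (rule remove_sings_eqI)
    moreover have "\<dots> \<noteq> 0" using r(3)[of w] r(1) P_nz[of w "Z - {w}"] by auto
    ultimately show ?thesis
      using remove_sings_analytic_at[OF iso lim] pos by (simp add: c_def)
  qed
  have "c analytic_on {z}" for z
    using at_Z[of z] remove_sings_analytic_on[OF ana[of z]] by (cases "z \<in> Z") (auto simp: c_def)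
  hence "c holomorphic_on UNIV"
    by (metis analytic_imp_holomorphic analytic_on_analytic_at)
  moreover have "g z = c z * P Z z" for z
  proof (cases "z \<in> Z")
    case False
    thus ?thesis using remove_sings_at_analytic[OF ana[of z]] P_nz[of z Z] by (simp add: c_def)
  next
    case True
    hence "P Z z = 0" using at_Z[of z] Z(1) by (auto simp: P_def intro!: bexI[of _ z])
    thus ?thesis using Z(2)[OF True] by simp
  qed
  ultimately show ?thesis using that at_Z by (simp add: P_def)
qed

section \<open>Division and counting of zeros\<close>

text \<open>For \<open>norm z = R\<close> the right-hand side vanishes, so the Blaschke factor
  \<open>R * (z - w) / (R^2 - cnj w * z)\<close> has modulus 1 on the circle.\<close>

lemma blaschke_identity:
  fixes z w :: complex and R :: real
  shows "(norm (of_real (R\<^sup>2) - cnj w * z))\<^sup>2 - (norm (of_real R * (z - w)))\<^sup>2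
           = (R\<^sup>2 - (norm z)\<^sup>2) * (R\<^sup>2 - (norm w)\<^sup>2)"
  unfolding cmod_power2 by (simp add: power2_eq_square algebra_simps)

text \<open>Dividing out a finite Blaschke product formed with the given zeros does not change the
  modulus on the circle, so that the quotient inherits bounds from there.\<close>
lemma blaschke_division:
  assumes g: "g holomorphic_on UNIV" "g p \<noteq> 0"
    and Z: "finite Z" "\<And>w. w \<in> Z \<Longrightarrow> g w = 0" "Z \<subseteq> ball 0 R" and R: "R > 0"
  obtains c \<beta> where "c holomorphic_on UNIV"
    "\<And>z. z \<in> cball 0 R \<Longrightarrow> g z = c z * \<beta> z" "\<And>z. norm z = R \<Longrightarrow> norm (\<beta> z) = 1"
    "\<And>z. z \<in> ball 0 R \<Longrightarrow> c z = 0 \<Longrightarrow> g z = 0 \<and> z \<notin> Z"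
    "norm (\<beta> 0) = (\<Prod>w\<in>Z. (norm w / R) ^ nat (zorder g w))"
proof -
  obtain d where d: "d holomorphic_on UNIV"
    "\<And>z. g z = d z * (\<Prod>w\<in>Z. (z - w) ^ nat (zorder g w))" "\<And>w. w \<in> Z \<Longrightarrow> d w \<noteq> 0"
    by (rule holomorphic_divide_zeros[OF g Z(1,2)]) (assumption, (rule that; assumption))
  \<comment> \<open>Each \<open>z - w\<close> splits into a part without zeros on the closed disc,
    collected in \<open>Q\<close> and kept in the quotient, and a Blaschke factor, collected in
    \<open>\<beta>\<close>.\<close>
  define Q where "Q = (\<lambda>z. \<Prod>w\<in>Z. ((of_real (R\<^sup>2) - cnj w * z) / of_real R) ^ nat (zorder g w))"
  define \<beta> where "\<beta> = (\<lambda>z. \<Prod>w\<in>Z. (of_real R * (z - w) / (of_real (R\<^sup>2) - cnj w * z)) ^ nat (zorder g w))"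
  have nz: "of_real (R\<^sup>2) - cnj w * z \<noteq> 0" if "w \<in> Z" "z \<in> cball 0 R" for w z
  proof
    assume "of_real (R\<^sup>2) - cnj w * z = 0"
    hence "norm (of_real (R\<^sup>2) :: complex) = norm (cnj w * z)" by simp
    hence "R * R = norm w * norm z" by (simp add: norm_mult power2_eq_square)
    moreover have "norm w * norm z \<le> norm w * R" using that by (intro mult_left_mono) auto
    moreover have "norm w * R < R * R" using that Z(3) R by (intro mult_strict_right_mono) auto
    ultimately show False by linarith
  qed
  have eq: "(\<Prod>w\<in>Z. (z - w) ^ nat (zorder g w)) = Q z * \<beta> z" if "z \<in> cball 0 R" for z
    unfolding Q_def \<beta>_def prod.distrib[symmetric] power_mult_distrib[symmetric]
  proof (intro prod.cong refl arg_cong2[of _ _ _ _ "(^)"])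
    fix w assume "w \<in> Z"
    from nz[OF this that] show "z - w = (of_real (R\<^sup>2) - cnj w * z) / of_real R *
       (of_real R * (z - w) / (of_real (R\<^sup>2) - cnj w * z))" using R by (simp add: field_simps)
  qed
  show ?thesis
  proof (rule that[of "\<lambda>z. d z * Q z" \<beta>])
    show "(\<lambda>z. d z * Q z) holomorphic_on UNIV"
      unfolding Q_def using R by (intro holomorphic_intros d) auto
    show "g z = d z * Q z * \<beta> z" if "z \<in> cball 0 R" for z
      using d(2)[of z] eq[OF that] by simp
    show "norm (\<beta> z) = 1" if "norm z = R" for z
    proof -
      have "norm (of_real R * (z - w) / (of_real (R\<^sup>2) - cnj w * z)) = 1" if "w \<in> Z" for w
      proof -
        have "(norm (of_real (R\<^sup>2) - cnj w * z))\<^sup>2 = (norm (of_real R * (z - w)))\<^sup>2"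
          using blaschke_identity[of R w z] \<open>norm z = R\<close> by simp
        hence "norm (of_real (R\<^sup>2) - cnj w * z) = norm (of_real R * (z - w))"
          by (rule power2_eq_imp_eq) auto
        moreover have "norm (of_real (R\<^sup>2) - cnj w * z) \<noteq> 0"
          using nz[OF that, of z] \<open>norm z = R\<close> by auto
        ultimately show ?thesis by (simp only: norm_divide) simp
      qed
      thus ?thesis unfolding \<beta>_def prod_norm[symmetric] norm_power by simp
    qed
    show "g z = 0 \<and> z \<notin> Z" if "z \<in> ball 0 R" "d z * Q z = 0" for z
    proof -
      have "Q z \<noteq> 0" using nz[of _ z] that R Z(1) unfolding Q_def by auto
      thus ?thesis using that d by auto
    qed
    show "norm (\<beta> 0) = (\<Prod>w\<in>Z. (norm w / R) ^ nat (zorder g w))"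
      unfolding \<beta>_def prod_norm[symmetric] norm_power
      using R by (intro prod.cong refl arg_cong2[of _ _ _ _ "(^)"])
         (simp add: norm_divide norm_mult power2_eq_square)
  qed
qed

section \<open>Jensen's bound and quotients of functions of finite order\<close>

lemma norm_le_on_cball_of_sphere:
  assumes "c holomorphic_on UNIV" "\<And>z. norm z = R \<Longrightarrow> norm (c z) \<le> M" "norm z \<le> R"
  shows "norm (c z) \<le> M"
proof (rule maximum_modulus_frontier[where S = "cball 0 R" and f = c and \<xi> = z])
  show "c holomorphic_on interior (cball 0 R)" using assms(1) holomorphic_on_subset by blast
  show "continuous_on (closure (cball 0 R)) c"
    using assms(1) holomorphic_on_imp_continuous_on continuous_on_subset by blast
qed (use assms in auto)

text \<open>Jensen's inequality in product form: each zero in the half-radius disc, counted with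
  multiplicity, contributes a factor of at most 1/2 to the Blaschke product at 0, while the quotient
  is at most \<open>M\<close> there.\<close>

lemma zero_count_bound:
  assumes g: "g holomorphic_on UNIV" "g 0 \<noteq> 0"
    and Z: "finite Z" "\<And>w. w \<in> Z \<Longrightarrow> g w = 0 \<and> norm w \<le> R / 2" and R: "R > 0"
    and M: "\<And>z. norm z = R \<Longrightarrow> norm (g z) \<le> M"
  shows "norm (g 0) * 2 ^ (\<Sum>w\<in>Z. nat (zorder g w)) \<le> M"
proof -
  have Z0: "Z \<subseteq> ball 0 R" and Z1: "\<And>w. w \<in> Z \<Longrightarrow> g w = 0" using Z(2) R by fastforce+
  obtain c \<beta> where c: "c holomorphic_on UNIV"
    "\<And>z. z \<in> cball 0 R \<Longrightarrow> g z = c z * \<beta> z" "\<And>z. norm z = R \<Longrightarrow> norm (\<beta> z) = 1"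
    "norm (\<beta> 0) = (\<Prod>w\<in>Z. (norm w / R) ^ nat (zorder g w))"
    by (rule blaschke_division[OF g Z(1) Z1 Z0 R]) (assumption, (rule that; assumption))
  have "norm (c z) = norm (g z)" if "norm z = R" for z
    using c(2)[of z] c(3)[OF that] that by (simp add: norm_mult)
  hence "norm (c 0) \<le> M"
    using norm_le_on_cball_of_sphere[OF c(1), of R M 0] M R by simp
  have "norm (\<beta> 0) \<le> (\<Prod>w\<in>Z. (1 / 2) ^ nat (zorder g w))"
    unfolding c(4) using Z(2) R by (intro prod_mono conjI power_mono) (auto simp: field_simps)
  also have "\<dots> = (1 / 2) ^ (\<Sum>w\<in>Z. nat (zorder g w))"
    by (simp add: power_sum)
  finally have "norm (g 0) \<le> M * (1 / 2) ^ (\<Sum>w\<in>Z. nat (zorder g w))"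
    using c(2)[of 0] R \<open>norm (c 0) \<le> M\<close> order_trans[OF norm_ge_zero \<open>norm (c 0) \<le> M\<close>]
    by (auto simp: norm_mult intro!: mult_mono)
  thus ?thesis by (simp add: field_simps power_divide)
qed

lemma finite_zeros_cball:
  fixes g :: "complex \<Rightarrow> complex"
  assumes "g holomorphic_on UNIV" "g p \<noteq> 0"
  shows "finite {z \<in> cball q R. g z = 0}"
proof (cases "g constant_on UNIV")
  case True
  hence "{z \<in> cball q R. g z = 0} = {}" using assms(2) by (metis (mono_tags, lifting) Collect_empty_eq UNIV_I constant_on_def)
  thus ?thesis by (metis finite.emptyI)
next
  case False
  thus ?thesis using holomorphic_compact_finite_zeros[OF assms(1) open_UNIV connected_UNIV, of "cball q R"] by auto
qed

text \<open>Replacing \<open>b\<close> by its zero-free Blaschke quotient \<open>c\<close> leaves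
  the modulus on the circle unchanged, so \<open>q * c\<close> inherits the bound
  \<open>exp A\<close> by the maximum principle. A lower bound for \<open>c\<close> comes from
  Borel-Caratheodory applied to its logarithm.\<close>

lemma norm_quotient_le:
  assumes q: "q holomorphic_on UNIV" and b: "b holomorphic_on UNIV" "b 0 \<noteq> 0" and R: "R > 0"
    and A: "\<And>z. norm z = R \<Longrightarrow> norm (q z * b z) \<le> exp A"
    and B: "\<And>z. norm z = R \<Longrightarrow> norm (b z) \<le> exp B"
    and z: "norm z \<le> R / 2"
  shows "norm (q z) \<le> exp (A + 2 * (B + 1) - 3 * ln (norm (b 0)))"
proof -
  define Z where "Z = {z \<in> ball 0 R. b z = 0}"
  have Z: "finite Z" by (rule finite_subset[OF _ finite_zeros_cball[OF b, of 0 R]]) (auto simp: Z_def)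
  have Z1: "\<And>w. w \<in> Z \<Longrightarrow> b w = 0" and Z2: "Z \<subseteq> ball 0 R" by (auto simp: Z_def)
  obtain c \<beta> where c: "c holomorphic_on UNIV"
    "\<And>z. z \<in> cball 0 R \<Longrightarrow> b z = c z * \<beta> z" "\<And>z. norm z = R \<Longrightarrow> norm (\<beta> z) = 1"
    "\<And>z. z \<in> ball 0 R \<Longrightarrow> c z = 0 \<Longrightarrow> b z = 0 \<and> z \<notin> Z"
    "norm (\<beta> 0) = (\<Prod>w\<in>Z. (norm w / R) ^ nat (zorder b w))"
    by (rule blaschke_division[OF b Z Z1 Z2 R]) (assumption, (rule that; assumption))
  have nz: "c z \<noteq> 0" if "z \<in> ball 0 R" for z using c(4)[OF that] that by (auto simp: Z_def)
  have "norm (c z) \<le> exp B" if "norm z \<le> R" for z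
  proof (rule norm_le_on_cball_of_sphere[OF c(1)])
    show "norm (c z) \<le> exp B" if "norm z = R" for z
      using B[OF that] c(2)[of z] c(3)[OF that] that by (simp add: norm_mult)
  qed fact
  hence cB: "norm (c z) < exp (B + 1)" if "norm z \<le> R" for z
    using that by (smt (verit) exp_less_cancel_iff)
  have qc: "norm (q z * c z) \<le> exp A"
  proof (rule norm_le_on_cball_of_sphere[where c = "\<lambda>z. q z * c z"])
    show "norm (q z * c z) \<le> exp A" if "norm z = R" for z
      using A[OF that] c(2)[of z] c(3)[OF that] that by (simp add: norm_mult)
  qed (use z R in \<open>auto intro!: holomorphic_intros q c\<close>)
  obtain L where L: "L holomorphic_on ball 0 R" "\<And>z. z \<in> ball 0 R \<Longrightarrow> exp (L z) = c z"
    using holomorphic_logarithm_exists[of "ball 0 R" c 0] holomorphic_on_subset[OF c(1)] nz R by auto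
  have ReL: "Re (L z) < B + 1" if "z \<in> ball 0 R" for z
  proof -
    have "exp (Re (L z)) < exp (B + 1)" using L(2)[OF that] cB[of z] that by (metis norm_exp_eq_Re mem_ball_0 less_imp_le)
    thus ?thesis by simp
  qed
  have zb: "z \<in> ball 0 R" using z R by auto
  have t: "dist 0 z / R \<le> 1 / 2" "dist 0 z / R \<ge> 0" using z R by (auto simp: field_simps)
  have "1/2 * norm (L z - L 0) \<le> (1 - dist 0 z / R) * norm (L z - L 0)"
    using t by (intro mult_right_mono) auto
  also have "\<dots> \<le> 2 * (dist 0 z / R) * (B + 1 - Re (L 0))"
    by (rule borel_caratheodory(1)[OF L(1) ReL zb])
  also have "\<dots> \<le> 1 * (B + 1 - Re (L 0))"
    using t ReL[of 0] R by (intro mult_right_mono) auto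
  finally have "norm (L z - L 0) \<le> 2 * (B + 1 - Re (L 0))" by simp
  \<comment> \<open>On the half-radius disc \<open>t\<close> is at most 1/2, whence the factors 2
    and 3. The 1 added to \<open>B\<close> makes the bound on \<open>Re (L z)\<close>
    strict.\<close>
  hence lower: "Re (L z) \<ge> 3 * Re (L 0) - 2 * (B + 1)"
    using complex_Re_le_cmod[of "L 0 - L z"] by (simp add: norm_minus_commute)
  have "norm (\<beta> 0) \<le> 1"
    unfolding c(5) using R by (intro prod_le_1 conjI power_le_one) (auto simp: Z_def)
  hence "norm (b 0) \<le> norm (c 0) * 1"
    using c(2)[of 0] R mult_left_mono[of "norm (\<beta> 0)" 1 "norm (c 0)"] by (simp add: norm_mult)
  also have "norm (c 0) = exp (Re (L 0))" using L(2)[of 0] R by (metis norm_exp_eq_Re centre_in_ball)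
  finally have "ln (norm (b 0)) \<le> Re (L 0)"
    using b(2) by (metis exp_le_cancel_iff exp_ln mult.right_neutral zero_less_norm_iff)
  hence "3 * ln (norm (b 0)) - 2 * (B + 1) \<le> Re (L z)" using lower by linarith
  hence "exp (3 * ln (norm (b 0)) - 2 * (B + 1)) \<le> norm (c z)"
    using L(2)[OF zb] by (metis exp_le_cancel_iff norm_exp_eq_Re)
  hence "norm (q z) * exp (3 * ln (norm (b 0)) - 2 * (B + 1)) \<le> norm (q z) * norm (c z)"
    by (intro mult_left_mono) auto
  also have "\<dots> \<le> exp A" using qc by (simp add: norm_mult)
  finally have "norm (q z) \<le> exp A / exp (3 * ln (norm (b 0)) - 2 * (B + 1))"
    by (simp add: field_simps)
  also have "\<dots> = exp (A - (3 * ln (norm (b 0)) - 2 * (B + 1)))" by (simp only: exp_diff)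
  finally show ?thesis by (simp add: algebra_simps)
qed

text \<open>Recentring at \<open>p\<close> makes the denominator nonzero at 0. The circle of radius
  \<open>2 * (1 + norm s)\<close> is chosen so that \<open>s\<close> lies in the half-radius
  disc.\<close>

lemma entire_finite_order_quotient:
  assumes q: "q holomorphic_on UNIV" and b: "entire_finite_order b" "b p \<noteq> 0"
    and a: "entire_finite_order (\<lambda>z. q z * b z)"
  shows "entire_finite_order q"
proof -
  define q' where "q' = (\<lambda>z. q (z + p))"
  define b' where "b' = (\<lambda>z. b (z + p))"
  have q': "q' holomorphic_on UNIV"
    unfolding q'_def by (intro holomorphic_on_compose_gen[OF _ q, unfolded o_def] holomorphic_intros) auto
  have "entire_finite_order (\<lambda>z. q' z * b' z)"
    using entire_finite_order_shift[OF a, of p] by (simp add: q'_def b'_def)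
  then obtain A n where A: "A \<ge> 0" "\<And>s. norm (q' s * b' s) \<le> exp (A * (1 + norm s) ^ n)"
    by (rule entire_finite_orderE) blast
  have "entire_finite_order b'"
    using entire_finite_order_shift[OF b(1), of p] by (simp add: b'_def)
  then obtain B m where B: "B \<ge> 0" "\<And>s. norm (b' s) \<le> exp (B * (1 + norm s) ^ m)" "b' holomorphic_on UNIV"
    by (rule entire_finite_orderE) blast
  have b'0: "b' 0 \<noteq> 0" using b(2) by (simp add: b'_def)
  define E where "E = \<bar>2 - 3 * ln (norm (b' 0))\<bar>"
  have "entire_finite_order q'"
  proof (rule entire_finite_orderI[OF q', where A = "(A + 2 * B) * 3 ^ max n m + E" and n = "max n m"])
    fix s :: complex
    define x where "x = 1 + norm s"
    have x: "x \<ge> 1" by (simp add: x_def)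
    define R where "R = 2 * x"
    have R: "R > 0" "norm s \<le> R / 2" using x by (simp_all add: R_def) (simp add: x_def)
    have "norm (q' s) \<le> exp (A * (1 + R) ^ n + 2 * (B * (1 + R) ^ m + 1) - 3 * ln (norm (b' 0)))"
      by (rule norm_quotient_le[OF q' B(3) b'0 R(1) _ _ R(2)]) (use A(2) B(2) in metis)+
    also have "\<dots> \<le> exp (((A + 2 * B) * 3 ^ max n m + E) * x ^ max n m)"
    proof (rule exp_le_cancel_iff[THEN iffD2])
      have le: "(1 + R) ^ k \<le> 3 ^ max n m * x ^ max n m" if "k \<le> max n m" for k
      proof -
        have "(1 + R) ^ k \<le> (1 + R) ^ max n m"
          using that R by (intro power_increasing) auto
        also have "\<dots> \<le> (3 * x) ^ max n m"
          using x by (intro power_mono) (auto simp: R_def)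
        finally show ?thesis by (simp add: power_mult_distrib)
      qed
      have "A * (1 + R) ^ n \<le> A * (3 ^ max n m * x ^ max n m)"
           "B * (1 + R) ^ m \<le> B * (3 ^ max n m * x ^ max n m)"
        using A(1) B(1) by (intro mult_left_mono le; simp)+
      moreover have "E * 1 \<le> E * x ^ max n m"
        using x by (intro mult_left_mono) (auto simp: E_def)
      moreover have "2 - 3 * ln (norm (b' 0)) \<le> E" by (simp add: E_def)
      ultimately show "A * (1 + R) ^ n + 2 * (B * (1 + R) ^ m + 1) - 3 * ln (norm (b' 0))
                         \<le> ((A + 2 * B) * 3 ^ max n m + E) * x ^ max n m"
        by (simp add: algebra_simps)
    qed
    finally show "norm (q' s) \<le> exp (((A + 2 * B) * 3 ^ max n m + E) * (1 + norm s) ^ max n m)"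
      by (simp add: x_def)
  qed
  from entire_finite_order_shift[OF this, of "-p"] show ?thesis by (simp add: q'_def)
qed

section \<open>Canonical products of finite order\<close>

text \<open>For small \<open>u\<close> the factor is 1 up to order \<open>p + 1\<close>. For
  \<open>norm u > 1/2\<close> the number \<open>2 * norm u\<close> exceeds 1, so its power
  \<open>p + 1\<close> dominates the lower powers in the exponent. The constant adds up the two
  cases.\<close>

lemma weierstrass_factor_norm_le:
  "norm (weierstrass_factor p u) \<le> exp ((3 + 2 ^ Suc p * (real p + 1)) * norm u ^ Suc p)"
proof (cases "norm u \<le> 1 / 2")
  case True
  have "norm (weierstrass_factor p u) \<le> 1 + norm (weierstrass_factor p u - 1)"
    by (metis add.commute diff_add_cancel norm_one norm_triangle_ineq)
  also have "\<dots> \<le> 1 + 3 * norm u ^ Suc p"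
    using weierstrass_factor_bound[OF True] by simp
  also have "\<dots> \<le> exp (3 * norm u ^ Suc p)" by (rule exp_ge_add_one_self)
  also have "\<dots> \<le> exp ((3 + 2 ^ Suc p * (real p + 1)) * norm u ^ Suc p)"
    by (simp add: algebra_simps)
  finally show ?thesis .
next
  case False
  define v where "v = 2 * norm u"
  have v: "v \<ge> 1" using False by (simp add: v_def)
  have "norm (1 - u) \<le> 1 + norm u" using norm_triangle_ineq4[of 1 u] by simp
  also have "\<dots> \<le> exp (norm u)" by (rule exp_ge_add_one_self)
  also have "norm u \<le> v ^ Suc p"
    using power_increasing[of 1 "Suc p" v] v norm_ge_zero[of u]
    by (simp add: v_def del: power_Suc norm_ge_zero)
  finally have 1: "norm (1 - u) \<le> exp (v ^ Suc p)" by simp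
  have "norm (\<Sum>k=1..p. u ^ k / of_nat k) \<le> (\<Sum>k=1..p. v ^ Suc p)"
  proof (rule sum_norm_le)
    fix k assume k: "k \<in> {1..p}"
    have "norm (u ^ k / of_nat k) = norm u ^ k / real k" by (simp add: norm_divide norm_power)
    also have "\<dots> \<le> norm u ^ k / 1" using k by (intro divide_left_mono) auto
    also have "\<dots> \<le> v ^ k" unfolding v_def div_by_1 by (intro power_mono) auto
    also have "\<dots> \<le> v ^ Suc p" using k v by (intro power_increasing) auto
    finally show "norm (u ^ k / of_nat k) \<le> v ^ Suc p" .
  qed
  also have "\<dots> = real p * v ^ Suc p" by simp
  finally have 2: "norm (exp (\<Sum>k=1..p. u ^ k / of_nat k)) \<le> exp (real p * v ^ Suc p)"
    using complex_Re_le_cmod order_trans by (metis exp_le_cancel_iff norm_exp_eq_Re)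
  have "norm (weierstrass_factor p u) \<le> exp (v ^ Suc p) * exp (real p * v ^ Suc p)"
    unfolding weierstrass_factor_def norm_mult by (intro mult_mono 1 2) auto
  also have "\<dots> = exp (2 ^ Suc p * (real p + 1) * norm u ^ Suc p)"
    by (simp add: exp_add[symmetric] v_def power_mult_distrib algebra_simps)
  also have "\<dots> \<le> exp ((3 + 2 ^ Suc p * (real p + 1)) * norm u ^ Suc p)"
    by (simp add: algebra_simps)
  finally show ?thesis .
qed

lemma entire_finite_order_weierstrass_product:
  assumes "weierstrass_product a (\<lambda>_. p)"
  shows "entire_finite_order (weierstrass_product.f a (\<lambda>_. p))"
proof -
  interpret weierstrass_product a "\<lambda>_. p" by fact
  define K where "K = 3 + 2 ^ Suc p * (real p + 1)"
  have K: "K \<ge> 0" by (simp add: K_def)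
  define S where "S = (\<Sum>n. (1 / norm (a n)) ^ Suc p)"
  have summ: "summable (\<lambda>n. (1 / norm (a n)) ^ Suc p)" by (rule summable_a_p) simp
  have S: "S \<ge> 0" unfolding S_def by (intro suminf_nonneg summ) simp
  show ?thesis
  proof (rule entire_finite_orderI[where A = "K * S" and n = "Suc p"])
    fix z :: complex
    have part: "norm (\<Prod>n<N. weierstrass_factor p (z / a n)) \<le> exp (K * S * (1 + norm z) ^ Suc p)" for N
    proof -
      have "norm (\<Prod>n<N. weierstrass_factor p (z / a n))
              \<le> (\<Prod>n<N. exp (K * norm (z / a n) ^ Suc p))"
        unfolding prod_norm[symmetric]
        by (intro prod_mono conjI) (use weierstrass_factor_norm_le in \<open>auto simp: K_def\<close>)
      also have "\<dots> = exp (\<Sum>n<N. K * norm (z / a n) ^ Suc p)"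
        by (simp add: exp_sum)
      also have "(\<Sum>n<N. K * norm (z / a n) ^ Suc p) = K * norm z ^ Suc p * (\<Sum>n<N. (1 / norm (a n)) ^ Suc p)"
        unfolding sum_distrib_left
        by (intro sum.cong refl) (simp add: norm_divide power_divide field_simps)
      also have "\<dots> \<le> K * norm z ^ Suc p * S"
        unfolding S_def using K by (intro mult_left_mono sum_le_suminf summ) auto
      also have "\<dots> \<le> K * (1 + norm z) ^ Suc p * S"
        using K S by (intro mult_right_mono mult_left_mono power_mono) auto
      finally show ?thesis by (simp add: mult_ac)
    qed
    have "(\<lambda>n. \<Prod>i\<le>n. weierstrass_factor p (z / a i)) \<longlonglongrightarrow> f z"
      using convergent_prod_LIMSEQ[OF convergent[of z]] by (simp add: f_def)
    thus "norm (f z) \<le> exp (K * S * (1 + norm z) ^ Suc p)"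
      using part[of "Suc _"] unfolding lessThan_Suc_atMost
      by (intro Lim_bounded[OF tendsto_norm, where M = 0]) auto
  qed (rule holomorphic)
qed

lemma analytic_quotient_limit:
  assumes "b holomorphic_on UNIV" "b p \<noteq> 0" "W holomorphic_on UNIV" "W q \<noteq> 0"
    and "zorder b z \<le> zorder W z"
  shows "\<exists>c. (\<lambda>s. W s / b s) \<midarrow>z\<rightarrow> c"
proof -
  define g where "g = zor_poly b z"
  define h where "h = zor_poly W z"
  have "\<exists>w\<in>UNIV. b w \<noteq> 0" using assms(2) by blast
  from zorder_exist_zero[OF assms(1) open_UNIV connected_UNIV UNIV_I this, of z]
  obtain r where r: "r > 0" "g holomorphic_on cball z r" and rb:
    "\<And>w. w \<in> cball z r \<Longrightarrow> b w = g w * (w - z) ^ nat (zorder b z) \<and> g w \<noteq> 0"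
    unfolding g_def by metis
  have "\<exists>w\<in>UNIV. W w \<noteq> 0" using assms(4) by blast
  from zorder_exist_zero[OF assms(3) open_UNIV connected_UNIV UNIV_I this, of z]
  obtain r' where r': "r' > 0" "h holomorphic_on cball z r'" and rW:
    "\<And>w. w \<in> cball z r' \<Longrightarrow> W w = h w * (w - z) ^ nat (zorder W z) \<and> h w \<noteq> 0"
    unfolding h_def by metis
  define k where "k = nat (zorder W z) - nat (zorder b z)"
  have k: "nat (zorder W z) = k + nat (zorder b z)" using assms(5) by (simp add: k_def)
  have "(\<lambda>s. h s / g s * (s - z) ^ k) analytic_on {z}"
    by (intro analytic_intros holomorphic_on_imp_analytic_at[OF holomorphic_on_subset[OF r(2)], of "ball z r"]
           holomorphic_on_imp_analytic_at[OF holomorphic_on_subset[OF r'(2)], of "ball z r'"])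
       (use r(1) r'(1) rb[of z] in auto)
  from isContD[OF analytic_at_imp_isCont[OF this]]
  have "(\<lambda>s. h s / g s * (s - z) ^ k) \<midarrow>z\<rightarrow> h z / g z * (z - z) ^ k" .
  moreover have "eventually (\<lambda>w. w \<in> ball z (min r r') - {z}) (at z)"
    using r r' by (intro eventually_at_in_open) auto
  hence "eventually (\<lambda>s. h s / g s * (s - z) ^ k = W s / b s) (at z)"
  proof eventually_elim
    case (elim w)
    thus ?case using rb[of w] rW[of w] k by (auto simp: power_add)
  qed
  ultimately have "(\<lambda>s. W s / b s) \<midarrow>z\<rightarrow> h z / g z * (z - z) ^ k"
    using tendsto_cong by force
  thus ?thesis by blast
qed

text \<open>By Jensen's bound the counting function of the zeros grows polynomially, so a canonical
  product of fixed genus converges on the zeros in \<open>S\<close>, listed with multiplicity.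
  Infinitude allows an enumeration by the natural numbers.\<close>

lemma exists_finite_order_with_zeros_aux:
  assumes b: "entire_finite_order b" "b 0 \<noteq> 0" and inf: "infinite {z \<in> S. b z = 0}"
  obtains W where "entire_finite_order W" "\<And>z. z \<notin> S \<Longrightarrow> W z \<noteq> 0" "W 0 \<noteq> 0"
    "\<And>z. z \<in> S \<Longrightarrow> b z = 0 \<Longrightarrow> zorder W z = zorder b z"
proof -
  obtain A m where A: "A \<ge> 0" "\<And>s. norm (b s) \<le> exp (A * (1 + norm s) ^ m)" and hol: "b holomorphic_on UNIV"
    using b(1) by (rule entire_finite_orderE) blast
  define Z where "Z = {z \<in> S. b z = 0}"
  have fin: "finite (Z \<inter> cball 0 r)" for r
    by (rule finite_subset[OF _ finite_zeros_cball[OF hol b(2), of 0 r]]) (auto simp: Z_def)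
  have "closed Z"
    unfolding closed_limpt
  proof (intro allI impI)
    fix x assume "x islimpt Z"
    hence "x islimpt (Z \<inter> cball x 1)"
      by (rule islimpt_Int_eventually) (auto simp: eventually_at dist_commute intro!: exI[of _ 1])
    moreover have "finite (Z \<inter> cball x 1)"
      by (rule finite_subset[OF _ finite_zeros_cball[OF hol b(2), of x 1]]) (auto simp: Z_def)
    ultimately show "x \<in> Z" using islimpt_finite by blast
  qed
  have pos: "zorder b z > 0" if "b z = 0" for z
    by (rule holomorphic_divide_zeros[OF hol b(2), of "{z}"]) (use that in auto)
  have infZ: "infinite Z" using inf by (simp add: Z_def)
  have posZ: "\<And>z. z \<in> Z \<Longrightarrow> nat (zorder b z) > 0" using pos by (auto simp: Z_def)
  obtain a :: "nat \<Rightarrow> complex" where a: "mono (norm \<circ> a)" "range a = Z" "filterlim a at_infinity at_top"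
    and card: "\<And>z. z \<in> Z \<Longrightarrow> finite (a -` {z}) \<and> card (a -` {z}) = nat (zorder b z)"
    by (rule sequence_of_sparse_set_exists'[OF infZ \<open>closed Z\<close> fin posZ]) (assumption, (rule that; assumption))
  have a_nz: "a n \<noteq> 0" for n using rangeI[of a n] b(2) unfolding a(2) Z_def by auto
  \<comment> \<open>Jensen's bound on the circle of radius \<open>2 * r\<close>, with
    \<open>r = norm (a n)\<close>, gives
    \<open>norm (b 0) * 2 ^ Suc n <= exp (A * (1 + 2 * r) ^ m)\<close>. Taking logarithms and using
    \<open>1 + 2 * r <= 3 * (1 + r)\<close> yields this constant.\<close>
  define D where "D = (A * 3 ^ m + \<bar>ln (norm (b 0))\<bar>) / ln 2"
  have D: "D \<ge> 0" using A(1) by (simp add: D_def)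
  have count: "real (Suc n) \<le> D * (1 + norm (a n)) ^ Suc m" for n
  proof -
    define r where "r = norm (a n)"
    define Y where "Y = Z \<inter> cball 0 r"
    have "{..n} \<subseteq> (\<Union>z\<in>Y. a -` {z})"
    proof
      fix k assume "k \<in> {..n}"
      hence "norm (a k) \<le> r" using a(1) by (auto simp: r_def mono_def)
      thus "k \<in> (\<Union>z\<in>Y. a -` {z})" using a(2) by (auto simp: Y_def)
    qed
    moreover have finY: "finite Y" using fin by (simp add: Y_def)
    ultimately have "card {..n} \<le> card (\<Union>z\<in>Y. a -` {z})"
      using card by (intro card_mono finite_UN_I) (auto simp: Y_def)
    also have "\<dots> \<le> (\<Sum>z\<in>Y. card (a -` {z}))" by (rule card_UN_le[OF finY])
    also have "\<dots> = (\<Sum>z\<in>Y. nat (zorder b z))" using card by (intro sum.cong) (auto simp: Y_def)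
    finally have le: "Suc n \<le> (\<Sum>z\<in>Y. nat (zorder b z))" by simp
    have r: "r > 0" using a_nz by (simp add: r_def)
    have "norm (b 0) * 2 ^ (\<Sum>z\<in>Y. nat (zorder b z)) \<le> exp (A * (1 + 2 * r) ^ m)"
      by (rule zero_count_bound[OF hol b(2) finY, where R = "2 * r"])
         (use r A(2) in \<open>auto simp: Y_def Z_def\<close>, metis A(2))
    moreover have "norm (b 0) * 2 ^ Suc n \<le> norm (b 0) * 2 ^ (\<Sum>z\<in>Y. nat (zorder b z))"
      using le by (intro mult_left_mono power_increasing) auto
    ultimately have "norm (b 0) * 2 ^ Suc n \<le> exp (A * (1 + 2 * r) ^ m)" by linarith
    hence "ln (norm (b 0) * 2 ^ Suc n) \<le> A * (1 + 2 * r) ^ m"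
      using b(2) ln_le_cancel_iff[of "norm (b 0) * 2 ^ Suc n" "exp (A * (1 + 2 * r) ^ m)"] by simp
    hence "ln (norm (b 0)) + real (Suc n) * ln 2 \<le> A * (1 + 2 * r) ^ m"
      using b(2) by (simp add: ln_mult ln_realpow algebra_simps)
    also have "\<dots> \<le> A * (3 * (1 + r)) ^ m"
      using A(1) r by (intro mult_left_mono power_mono) auto
    also have "\<dots> = A * 3 ^ m * (1 + r) ^ m" by (simp only: power_mult_distrib mult.assoc)
    finally have "real (Suc n) * ln 2 \<le> A * 3 ^ m * (1 + r) ^ m - ln (norm (b 0)) * 1" by simp
    also have "\<dots> \<le> A * 3 ^ m * (1 + r) ^ m + \<bar>ln (norm (b 0))\<bar> * (1 + r) ^ m"
    proof -
      have "\<bar>ln (norm (b 0))\<bar> * 1 \<le> \<bar>ln (norm (b 0))\<bar> * (1 + r) ^ m"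
        using r by (intro mult_left_mono) auto
      thus ?thesis by linarith
    qed
    finally have "real (Suc n) * ln 2 \<le> (A * 3 ^ m + \<bar>ln (norm (b 0))\<bar>) * (1 + r) ^ m"
      by (simp add: algebra_simps)
    hence "real (Suc n) \<le> D * (1 + r) ^ m"
      by (simp add: D_def field_simps)
    also have "\<dots> \<le> D * (1 + r) ^ Suc m"
      using D r by (intro mult_left_mono power_increasing) auto
    finally show ?thesis by (simp add: r_def)
  qed
  define \<delta> where "\<delta> = norm (a 0)"
  have \<delta>: "\<delta> > 0" using a_nz by (simp add: \<delta>_def)
  \<comment> \<open>As all \<open>norm (a n)\<close> are at least \<open>\<delta>\<close>, the
    number \<open>1 + norm (a n)\<close> is at most
    \<open>(1 + 1 / \<delta>) * norm (a n)\<close>.\<close>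
  define E where "E = (D * (1 + 1 / \<delta>) ^ Suc m)"
  have E: "E \<ge> 0" using D \<delta> by (simp add: E_def)
  have inv: "(1 / norm (a n)) ^ Suc m \<le> E / real (Suc n)" for n
  proof -
    have "\<delta> \<le> norm (a n)" using a(1) by (simp add: mono_def \<delta>_def)
    hence "1 + norm (a n) \<le> (1 + 1 / \<delta>) * norm (a n)"
      using \<delta> by (simp add: field_simps)
    hence "D * (1 + norm (a n)) ^ Suc m \<le> D * ((1 + 1 / \<delta>) * norm (a n)) ^ Suc m"
      using D by (intro mult_left_mono power_mono) auto
    also have "\<dots> = E * norm (a n) ^ Suc m"
      by (simp only: E_def power_mult_distrib mult_ac)
    finally have "real (Suc n) \<le> E * norm (a n) ^ Suc m" using count[of n] by linarith
    thus ?thesis using a_nz[of n] by (simp add: field_simps power_divide del: power_Suc of_nat_Suc)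
  qed
  \<comment> \<open>Now \<open>p + 1 = 2 * (m + 1)\<close>, so squaring \<open>inv\<close> bounds
    the terms by a multiple of \<open>1 / (n + 1)^2\<close>.\<close>
  define p where "p = 2 * m + 1"
  have p: "Suc p = Suc m + Suc m" by (simp add: p_def)
  interpret weierstrass_product a "\<lambda>_. p"
  proof
    fix x :: real assume x: "x > 0"
    show "summable (\<lambda>n. (x / norm (a n)) ^ Suc p)"
    proof (rule summable_comparison_test_ev[OF always_eventually], intro allI)
      fix n
      have "(1 / norm (a n)) ^ Suc m * (1 / norm (a n)) ^ Suc m \<le> (E / real (Suc n)) * (E / real (Suc n))"
        using E by (intro mult_mono inv) auto
      hence "(1 / norm (a n)) ^ Suc p \<le> E\<^sup>2 * (1 / real (Suc n) ^ 2)"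
        unfolding p power_add by (simp add: power2_eq_square)
      hence "x ^ Suc p * (1 / norm (a n)) ^ Suc p \<le> x ^ Suc p * (E\<^sup>2 * (1 / real (Suc n) ^ 2))"
        using x by (intro mult_left_mono) auto
      moreover have "norm ((x / norm (a n)) ^ Suc p) = x ^ Suc p * (1 / norm (a n)) ^ Suc p"
        using x by (simp add: power_divide abs_mult del: power_Suc)
      ultimately show "norm ((x / norm (a n)) ^ Suc p) \<le> x ^ Suc p * (E\<^sup>2 * (1 / real (Suc n) ^ 2))"
        by (simp only:)
    next
      have "summable (\<lambda>n. 1 / real (Suc n) ^ 2)"
        using inverse_power_summable[of 2, where 'a = real]
        by (subst summable_Suc_iff) (simp add: inverse_eq_divide)
      thus "summable (\<lambda>n. x ^ Suc p * (E\<^sup>2 * (1 / real (Suc n) ^ 2)))"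
        by (intro summable_mult)
    qed
  qed (use a_nz a(3) in auto)
  show ?thesis
  proof (rule that[of f])
    show "entire_finite_order f"
      by (rule entire_finite_order_weierstrass_product) unfold_locales
    show "f z \<noteq> 0" if "z \<notin> S" for z
      using that zero[of z] a(2) by (auto simp: Z_def)
    show "f 0 \<noteq> 0" using zero[of 0] a_nz by auto
    show "zorder f z = zorder b z" if "z \<in> S" "b z = 0" for z
      using zorder[of z] card[of z] that pos[of z] by (simp add: Z_def)
  qed
qed

text \<open>The quotient is controlled inside \<open>S\<close> only: elsewhere \<open>b\<close> may
  vanish, while \<open>W\<close> does not. A finite limit is the form in which removable
  singularities are used later.\<close>

lemma exists_finite_order_with_zeros:
  assumes b: "entire_finite_order b" "b p \<noteq> 0" and inf: "infinite {z \<in> S. b z = 0}"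
  obtains W where "entire_finite_order W" "\<And>z. z \<notin> S \<Longrightarrow> W z \<noteq> 0"
    "\<And>z. z \<in> S \<Longrightarrow> \<exists>c. (\<lambda>s. W s / b s) \<midarrow>z\<rightarrow> c"
proof -
  define b' where "b' = (\<lambda>z. b (z + p))"
  define S' where "S' = {z. z + p \<in> S}"
  have b': "entire_finite_order b'" "b' 0 \<noteq> 0"
    using entire_finite_order_shift[OF b(1), of p] b(2) by (auto simp: b'_def)
  have "(\<lambda>z. z - p) ` {z \<in> S. b z = 0} \<subseteq> {z \<in> S'. b' z = 0}"
    by (auto simp: S'_def b'_def)
  moreover have "infinite ((\<lambda>z. z - p) ` {z \<in> S. b z = 0})"
    using inf by (subst finite_image_iff) (auto simp: inj_on_def)
  ultimately have inf': "infinite {z \<in> S'. b' z = 0}" using finite_subset by blast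
  obtain W where W: "entire_finite_order W" "\<And>z. z \<notin> S' \<Longrightarrow> W z \<noteq> 0" "W 0 \<noteq> 0"
    "\<And>z. z \<in> S' \<Longrightarrow> b' z = 0 \<Longrightarrow> zorder W z = zorder b' z"
    by (rule exists_finite_order_with_zeros_aux[OF b' inf']) (rule that; assumption)
  have hol: "b' holomorphic_on UNIV" "W holomorphic_on UNIV"
    using W b' by (auto simp: entire_finite_order_def)
  have lim: "\<exists>c. (\<lambda>s. W s / b' s) \<midarrow>z\<rightarrow> c" if "z \<in> S'" for z
  proof (cases "b' z = 0")
    case True
    thus ?thesis using analytic_quotient_limit[OF hol(1) b'(2) hol(2) W(3), of z] W(4)[OF that] by simp
  next
    case False
    have "(\<lambda>s. W s / b' s) analytic_on {z}"
      by (intro analytic_intros holomorphic_on_imp_analytic_at[OF hol(1)] holomorphic_on_imp_analytic_at[OF hol(2)])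
         (use False in auto)
    from isContD[OF analytic_at_imp_isCont[OF this]] show ?thesis by blast
  qed
  show ?thesis
  proof (rule that[of "\<lambda>z. W (z + (- p))"])
    show "entire_finite_order (\<lambda>z. W (z + - p))" by (rule entire_finite_order_shift[OF W(1)])
    show "W (z + - p) \<noteq> 0" if "z \<notin> S" for z
      using W(2)[of "z - p"] that by (auto simp: S'_def)
    show "\<exists>c. (\<lambda>s. W (s + - p) / b s) \<midarrow>z\<rightarrow> c" if z: "z \<in> S" for z
    proof -
      obtain c where "(\<lambda>s. W s / b' s) \<midarrow>z - p\<rightarrow> c" using lim[of "z - p"] z by (auto simp: S'_def)
      from LIM_offset[OF this, of "-p"] show ?thesis by (auto simp: b'_def)
    qed
  qed
qed

section \<open>The additive difference equation\<close>

abbreviation right_of :: "real \<Rightarrow> complex set" where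
  "right_of c \<equiv> {s. c < Re s}"

lemma open_right_of: "open (right_of c)" by (rule open_halfspace_Re_gt)
lemma convex_right_of: "convex (right_of c)" by (rule convex_halfspace_Re_gt)

definition poly_growth_on :: "complex set \<Rightarrow> (complex \<Rightarrow> complex) \<Rightarrow> bool" where
  "poly_growth_on U F \<longleftrightarrow> (\<exists>C n. \<forall>s\<in>U. norm (F s) \<le> C * (1 + norm s) ^ n)"

text \<open>The growth bound belongs to the notion because the order of the exponentiated solution
  is read off from it.\<close>

definition diff_solvable :: "(complex \<Rightarrow> complex) \<Rightarrow> bool" where
  "diff_solvable \<phi> \<longleftrightarrow> (\<exists>F. F holomorphic_on right_of 1 \<and> poly_growth_on (right_of 1) F \<and>
     (\<forall>s\<in>right_of 1. F (s + 1) - F s = \<phi> s))"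

text \<open>The solution is minus the sum of \<open>\<phi>\<close> over the shifts
  \<open>s + k\<close>. As \<open>1 + norm (s + k) <= (1 + norm s) * (k + 1)\<close> and
  \<open>Re (s + k) >= k + 1\<close>, the surplus of two in the exponent of \<open>Re s\<close>
  leaves terms of size \<open>(1 + norm s)^m / (k + 1)^2\<close>.\<close>

lemma diff_solvable_of_decay:
  assumes hol: "\<phi> holomorphic_on right_of 1"
    and b: "\<And>s. s \<in> right_of 1 \<Longrightarrow> norm (\<phi> s) \<le> C * (1 + norm s) ^ m / Re s ^ (m + 2)"
  shows "diff_solvable \<phi>"
proof -
  have C: "C \<ge> 0"
  proof -
    have "0 \<le> C * (1 + norm (2::complex)) ^ m / Re 2 ^ (m + 2)" by (rule order_trans[OF _ b]) auto
    thus ?thesis by (auto simp: zero_le_divide_iff zero_le_mult_iff power_le_zero_eq)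
  qed
  define M where "M = (\<lambda>r k. C * r ^ m * (1 / real (Suc k) ^ 2))"
  have summ1: "summable (\<lambda>k. 1 / real (Suc k) ^ 2)"
    using inverse_power_summable[of 2, where 'a = real]
    by (subst summable_Suc_iff) (simp add: inverse_eq_divide)
  hence summ: "summable (M r)" for r
    unfolding M_def by (intro summable_mult)
  have bound: "norm (\<phi> (s + of_nat k)) \<le> M r k" if s: "s \<in> right_of 1" "1 + norm s \<le> r" for s r k
  proof -
    have "norm (\<phi> (s + of_nat k)) \<le> C * (1 + norm (s + of_nat k)) ^ m / Re (s + of_nat k) ^ (m + 2)"
      using s by (intro b) auto
    also have "\<dots> \<le> C * (r * real (Suc k)) ^ m / real (Suc k) ^ (m + 2)"
    proof (intro frac_le mult_left_mono power_mono)
      have "1 + norm (s + of_nat k) \<le> 1 + (norm s + real k)"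
        using norm_triangle_ineq[of s "of_nat k"] by simp
      also have "\<dots> \<le> (1 + norm s) * real (Suc k)" by (simp add: algebra_simps)
      also have "\<dots> \<le> r * real (Suc k)" using s by (intro mult_right_mono) auto
      finally show "1 + norm (s + of_nat k) \<le> r * real (Suc k)" .
      have "0 \<le> r" using s(2) by (meson add_nonneg_nonneg norm_ge_zero order_trans zero_le_one)
      thus "0 \<le> C * (r * real (Suc k)) ^ m" using C by simp
    qed (use s C in auto)
    also have "\<dots> = M r k"
      unfolding M_def by (simp add: power_add power_mult_distrib power2_eq_square del: of_nat_Suc)
    finally show ?thesis .
  qed
  have summ_phi: "summable (\<lambda>k. \<phi> (s + of_nat k))" if "s \<in> right_of 1" for s
    by (rule summable_comparison_test_ev[OF always_eventually summ[of "1 + norm s"]]) (use bound that in auto)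
  define F where "F = (\<lambda>s. - (\<Sum>k. \<phi> (s + of_nat k)))"
  have "(\<lambda>s. \<Sum>k. \<phi> (s + of_nat k)) holomorphic_on right_of 1"
  proof (rule holomorphic_uniform_sequence[OF open_right_of])
    show "(\<lambda>s. \<Sum>k<n. \<phi> (s + of_nat k)) holomorphic_on right_of 1" for n
      by (intro holomorphic_intros holomorphic_on_compose_gen[OF _ hol, unfolded o_def]) auto
    fix x assume "x \<in> right_of 1"
    then obtain d where d: "d > 0" "cball x d \<subseteq> right_of 1"
      using open_right_of open_contains_cball by blast
    have "uniform_limit (cball x d) (\<lambda>n s. \<Sum>k<n. \<phi> (s + of_nat k)) (\<lambda>s. \<Sum>k. \<phi> (s + of_nat k)) sequentially"
    proof (rule Weierstrass_m_test[OF _ summ[of "1 + (norm x + d)"]])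
      fix k s assume s: "s \<in> cball x d"
      hence "s \<in> right_of 1" using d by blast
      thus "norm (\<phi> (s + of_nat k)) \<le> M (1 + (norm x + d)) k"
        using s norm_triangle_ineq2[of s x] by (intro bound) (auto simp: dist_norm norm_minus_commute)
    qed
    thus "\<exists>d>0. cball x d \<subseteq> right_of 1 \<and>
           uniform_limit (cball x d) (\<lambda>n s. \<Sum>k<n. \<phi> (s + of_nat k)) (\<lambda>s. \<Sum>k. \<phi> (s + of_nat k)) sequentially"
      using d by blast
  qed
  hence "F holomorphic_on right_of 1" unfolding F_def by (intro holomorphic_intros)
  moreover have "poly_growth_on (right_of 1) F"
    unfolding poly_growth_on_def
  proof (intro exI ballI)
    fix s assume s: "s \<in> right_of 1"
    have "norm (F s) = norm (\<Sum>k. \<phi> (s + of_nat k))" by (simp add: F_def)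
    also have "\<dots> \<le> (\<Sum>k. M (1 + norm s) k)"
      by (rule norm_suminf_le[OF _ summ]) (use s bound in auto)
    also have "\<dots> = C * (1 + norm s) ^ m * (\<Sum>k. 1 / real (Suc k) ^ 2)"
      unfolding M_def by (rule suminf_mult[OF summ1])
    finally show "norm (F s) \<le> (C * (\<Sum>k. 1 / real (Suc k) ^ 2)) * (1 + norm s) ^ m"
      by (simp add: mult_ac)
  qed
  moreover have "F (s + 1) - F s = \<phi> s" if "s \<in> right_of 1" for s
    using suminf_split_head[OF summ_phi[OF that]] by (simp add: F_def algebra_simps)
  ultimately show ?thesis unfolding diff_solvable_def by blast
qed

text \<open>A primitive of a solution for the derivative solves the equation up to a constant
  \<open>\<kappa>\<close>, which the linear term \<open>\<kappa> * s\<close> removes. Integration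
  along a segment from 2 raises the degree of growth by one.\<close>

lemma diff_solvable_of_deriv:
  assumes hol: "\<phi> holomorphic_on right_of 1" and "diff_solvable (deriv \<phi>)"
  shows "diff_solvable \<phi>"
proof -
  obtain G C n where G: "G holomorphic_on right_of 1"
    "\<And>s. s \<in> right_of 1 \<Longrightarrow> norm (G s) \<le> C * (1 + norm s) ^ n"
    "\<And>s. s \<in> right_of 1 \<Longrightarrow> G (s + 1) - G s = deriv \<phi> s"
    using assms(2) unfolding diff_solvable_def poly_growth_on_def by blast
  have C: "C \<ge> 0" using order_trans[OF norm_ge_zero G(2)[of 2]] by (auto simp: zero_le_mult_iff power_le_zero_eq)
  obtain H where H': "\<And>s. s \<in> right_of 1 \<Longrightarrow> (H has_field_derivative G s) (at s within right_of 1)"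
    using holomorphic_convex_primitive'[OF convex_right_of open_right_of G(1)] by blast
  have H: "(H has_field_derivative G s) (at s)" if "s \<in> right_of 1" for s
    using H'[OF that] by (simp only: at_within_open[OF that open_right_of])
  have "\<exists>\<kappa>. \<forall>s\<in>right_of 1. H (s + 1) - H s - \<phi> s = \<kappa>"
  proof (rule has_field_derivative_zero_constant[OF convex_right_of])
    fix s assume s: "s \<in> right_of 1"
    have "(\<phi> has_field_derivative deriv \<phi> s) (at s)"
      by (rule holomorphic_derivI[OF hol open_right_of s])
    moreover have "((\<lambda>s. H (s + 1)) has_field_derivative G (s + 1)) (at s)"
      using s H[of "s + 1"] by (simp add: DERIV_shift)
    ultimately have "((\<lambda>s. H (s + 1) - H s - \<phi> s) has_field_derivative G (s + 1) - G s - deriv \<phi> s) (at s)"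
      by (intro derivative_intros H s)
    thus "((\<lambda>s. H (s + 1) - H s - \<phi> s) has_field_derivative 0) (at s within right_of 1)"
      using G(3)[OF s] by (simp add: has_field_derivative_at_within)
  qed
  then obtain \<kappa> where \<kappa>: "\<And>s. s \<in> right_of 1 \<Longrightarrow> H (s + 1) - H s - \<phi> s = \<kappa>" by blast
  define F where "F = (\<lambda>s. H s - \<kappa> * s)"
  have "H holomorphic_on right_of 1"
    using H holomorphic_on_open[OF open_right_of] by blast
  hence "F holomorphic_on right_of 1" unfolding F_def by (intro holomorphic_intros)
  moreover have "F (s + 1) - F s = \<phi> s" if "s \<in> right_of 1" for s
    using \<kappa>[OF that] by (simp add: F_def algebra_simps)
  moreover have "poly_growth_on (right_of 1) F"
    unfolding poly_growth_on_def
  proof (intro exI ballI)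
    fix s assume s: "s \<in> right_of 1"
    define x where "x = 1 + norm s"
    have x: "x \<ge> 1" by (simp add: x_def)
    have seg: "closed_segment 2 s \<subseteq> right_of 1"
      using s convex_right_of by (intro closed_segment_subset) auto
    have "norm (H s - H 2) \<le> C * (3 * x) ^ n * norm (s - 2)"
    proof (rule field_differentiable_bound[of "closed_segment 2 s" H G])
      fix w assume w: "w \<in> closed_segment 2 s"
      thus "(H has_field_derivative G w) (at w within closed_segment 2 s)"
        using H seg has_field_derivative_at_within by blast
      have "closed_segment 2 s \<subseteq> cball 0 (max 2 (norm s))"
        by (intro closed_segment_subset) auto
      hence "norm w \<le> max 2 (norm s)" using w by auto
      also have "\<dots> \<le> 2 + 3 * norm s" by simp
      finally have "1 + norm w \<le> 3 * x" by (simp add: x_def)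
      hence "C * (1 + norm w) ^ n \<le> C * (3 * x) ^ n"
        using C by (intro mult_left_mono power_mono) auto
      thus "norm (G w) \<le> C * (3 * x) ^ n" using order_trans[OF G(2)[of w]] w seg by blast
    qed auto
    also have "\<dots> \<le> C * (3 * x) ^ n * (3 * x)"
      using C x norm_triangle_ineq4[of s 2] norm_ge_zero[of s]
      by (intro mult_left_mono) (auto simp: x_def intro: order_trans)
    also have "\<dots> = C * 3 ^ Suc n * x ^ Suc n" by (simp add: power_mult_distrib)
    finally have 1: "norm (H s - H 2) \<le> C * 3 ^ Suc n * x ^ Suc n" .
    have x1: "1 \<le> x ^ Suc n" using x by (rule one_le_power)
    have xx: "x \<le> x ^ Suc n" using power_increasing[OF _ x, of 1 "Suc n"] by (simp del: power_Suc)
    have "norm (F s) = norm ((H s - H 2) + (H 2 - \<kappa> * s))" by (simp add: F_def)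
    also have "\<dots> \<le> norm (H s - H 2) + (norm (H 2) + norm \<kappa> * norm s)"
      using norm_triangle_ineq[of "H s - H 2" "H 2 - \<kappa> * s"] norm_triangle_ineq4[of "H 2" "\<kappa> * s"]
      by (simp add: norm_mult)
    also have "norm (H 2) \<le> norm (H 2) * x ^ Suc n" using mult_left_mono[OF x1, of "norm (H 2)"] by simp
    also have "norm \<kappa> * norm s \<le> norm \<kappa> * x ^ Suc n" using order_trans[OF _ xx, of "norm s"]
      by (intro mult_left_mono) (simp_all add: x_def)
    finally show "norm (F s) \<le> (C * 3 ^ Suc n + norm (H 2) + norm \<kappa>) * (1 + norm s) ^ Suc n"
      using 1 unfolding x_def[symmetric] distrib_right by linarith
  qed
  ultimately show ?thesis unfolding diff_solvable_def by blast
qed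

lemma diff_solvable_of_higher_deriv:
  assumes "\<phi> holomorphic_on right_of 1" "diff_solvable ((deriv ^^ d) \<phi>)"
  shows "diff_solvable \<phi>"
  using assms
proof (induction d arbitrary: \<phi>)
  case (Suc d)
  have "diff_solvable ((deriv ^^ d) (deriv \<phi>))"
    using Suc.prems(2) by (simp only: funpow_Suc_right o_apply)
  hence "diff_solvable (deriv \<phi>)"
    by (rule Suc.IH[OF holomorphic_deriv[OF Suc.prems(1) open_right_of]])
  thus ?case by (rule diff_solvable_of_deriv[OF Suc.prems(1)])
qed auto

text \<open>The Cauchy estimate on the disc of radius \<open>Re s / 2\<close> gains a factor
  \<open>1 / Re s\<close> per derivative, so \<open>n + 2\<close> derivatives reach the required
  decay. For \<open>Re s > 1\<close> these discs stay where the bound is available.\<close>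

lemma diff_solvable_of_poly_growth:
  assumes hol: "\<phi> holomorphic_on right_of 0"
    and b: "\<And>s. Re s \<ge> 1/2 \<Longrightarrow> norm (\<phi> s) \<le> C * (1 + norm s) ^ n"
  shows "diff_solvable \<phi>"
proof (rule diff_solvable_of_higher_deriv)
  have sub: "right_of 1 \<subseteq> right_of 0" by auto
  show "\<phi> holomorphic_on right_of 1" by (rule holomorphic_on_subset[OF hol sub])
  show "diff_solvable ((deriv ^^ (n + 2)) \<phi>)"
  proof (rule diff_solvable_of_decay)
    show "(deriv ^^ (n + 2)) \<phi> holomorphic_on right_of 1"
      by (rule holomorphic_on_subset[OF holomorphic_higher_deriv[OF hol open_right_of] sub])
    fix s assume s: "s \<in> right_of 1"
    define r where "r = Re s / 2"
    have r: "r > 0" "r > 1/2" using s by (auto simp: r_def)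
    have C: "C \<ge> 0" using order_trans[OF norm_ge_zero b[of 1]] by (auto simp: zero_le_mult_iff power_le_zero_eq)
    have Re: "Re x \<ge> r" if "norm (s - x) \<le> r" for x
      using complex_Re_le_cmod[of "s - x"] that by (simp add: r_def)
    have sub': "cball s r \<subseteq> right_of 0" using Re r by (force simp: dist_norm)
    have "norm ((deriv ^^ (n + 2)) \<phi> s) \<le> fact (n + 2) * (C * (2 * (1 + norm s)) ^ n) / r ^ (n + 2)"
    proof (rule Cauchy_inequality)
      show "\<phi> holomorphic_on ball s r"
        by (rule holomorphic_on_subset[OF hol order_trans[OF ball_subset_cball sub']])
      show "continuous_on (cball s r) \<phi>"
        by (rule holomorphic_on_imp_continuous_on[OF holomorphic_on_subset[OF hol sub']])
      fix x assume x: "norm (s - x) = r"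
      have "norm x \<le> norm s + r" using norm_triangle_ineq4[of s "s - x"] x by simp
      also have "r \<le> norm s" using complex_Re_le_cmod[of s] r by (simp add: r_def)
      finally have "C * (1 + norm x) ^ n \<le> C * (2 * (1 + norm s)) ^ n"
        using C by (intro mult_left_mono power_mono) auto
      moreover have "1 / 2 \<le> Re x" using Re[of x] x r by linarith
      ultimately show "norm (\<phi> x) \<le> C * (2 * (1 + norm s)) ^ n" using b[of x] by linarith
    qed (use r in auto)
    also have "\<dots> = (fact (n + 2) * C * 2 ^ n * 2 ^ (n + 2)) * (1 + norm s) ^ n / Re s ^ (n + 2)"
      unfolding r_def power_divide power_mult_distrib by (simp only: divide_divide_eq_right mult_ac)
    finally show "norm ((deriv ^^ (n + 2)) \<phi> s) \<le>
       (fact (n + 2) * C * 2 ^ n * 2 ^ (n + 2)) * (1 + norm s) ^ n / Re s ^ (n + 2)" .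
  qed
qed

section \<open>The multiplicative difference equation\<close>

text \<open>The order of \<open>a\<close> bounds the real part of the logarithm from above only.
  Borel-Caratheodory is applied twice on a disc tangent to the imaginary axis at 0: from the point
  1, where \<open>L\<close> vanishes, to the centre, and from the centre to
  \<open>s\<close>.\<close>

lemma log_poly_growth:
  assumes a: "entire_finite_order a" "a 1 = 1" "\<And>s. Re s > 0 \<Longrightarrow> a s \<noteq> 0"
  obtains L C n where "L holomorphic_on right_of 0" "\<And>s. Re s > 0 \<Longrightarrow> exp (L s) = a s" "L 1 = 0"
    "\<And>s. Re s \<ge> 1/2 \<Longrightarrow> norm (L s) \<le> C * (1 + norm s) ^ n"
proof -
  obtain A m where A: "A \<ge> 0" "\<And>s. norm (a s) \<le> exp (A * (1 + norm s) ^ m)" and hol: "a holomorphic_on UNIV"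
    using a(1) by (rule entire_finite_orderE) blast
  have hol0: "a holomorphic_on right_of 0" using hol by (rule holomorphic_on_subset) auto
  have nz: "\<And>s. s \<in> right_of 0 \<Longrightarrow> a s \<noteq> 0" using a(3) by auto
  have one: "1 \<in> right_of 0" by simp
  obtain L0 where L0: "L0 holomorphic_on right_of 0" "\<And>s. s \<in> right_of 0 \<Longrightarrow> exp (L0 s) = a s"
    by (rule holomorphic_logarithm_exists[OF convex_right_of open_right_of hol0 nz one]) (assumption, (rule that; assumption))
  define L where "L = (\<lambda>s. L0 s - L0 1)"
  have L: "L holomorphic_on right_of 0" unfolding L_def by (intro holomorphic_intros L0)
  have expL: "exp (L s) = a s" if "Re s > 0" for s
    using L0(2)[of s] L0(2)[of 1] that a(2) by (simp add: L_def exp_diff)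
  have L1: "L 1 = 0" by (simp add: L_def)
  have ReL: "Re (L s) \<le> A * (1 + norm s) ^ m" if "Re s > 0" for s
    using A(2)[of s] expL[OF that] by (metis exp_le_cancel_iff norm_exp_eq_Re)
  have "norm (L s) \<le> 84 * (A * 5 ^ m + 1) * (1 + norm s) ^ (2 * m + 4)" if s: "Re s \<ge> 1/2" for s
  proof -
    define x where "x = 1 + norm s"
    have x: "x \<ge> 1" by (simp add: x_def)
    have x2: "x\<^sup>2 \<ge> 1" using x by (simp add: one_le_power)
    \<comment> \<open>A disc of centre and radius \<open>R\<close> contains a point \<open>s\<close>
      with real part 1/2 only if \<open>R > (norm s)^2\<close>; hence the quadratic size.\<close>
    define R where "R = 2 * x\<^sup>2"
    have R: "R \<ge> 2" using x2 by (simp add: R_def)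
    define c where "c = complex_of_real R"
    define M where "M = A * (1 + 2 * R) ^ m + 1"
    have M0: "M \<ge> 1" using A(1) R by (simp add: M_def)
    have ball: "Re z > 0 \<and> norm z \<le> 2 * R" if "z \<in> ball c R" for z
    proof
      have d: "norm (c - z) < R" using that by (simp add: dist_norm)
      thus "Re z > 0" using complex_Re_le_cmod[of "c - z"] by (simp add: c_def)
      show "norm z \<le> 2 * R" using norm_triangle_ineq4[of c "c - z"] d R by (simp add: c_def)
    qed
    have LM: "Re (L z) < M" if "z \<in> ball c R" for z
    proof -
      have "Re (L z) \<le> A * (1 + norm z) ^ m" using ReL ball[OF that] by blast
      also have "\<dots> \<le> A * (1 + 2 * R) ^ m"
        using ball[OF that] A(1) by (intro mult_left_mono power_mono) auto
      finally show ?thesis by (simp add: M_def)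
    qed
    have Lb: "L holomorphic_on ball c R"
      by (rule holomorphic_on_subset[OF L]) (use ball in auto)
    have d1: "dist c 1 = R - 1"
    proof -
      have "c - 1 = of_real (R - 1)" by (simp add: c_def)
      thus ?thesis unfolding dist_norm using R by (simp only: norm_of_real)
    qed
    have "1 \<in> ball c R" using d1 by simp
    \<comment> \<open>The bound in terms of the off-centre value: \<open>L 1 = 0\<close> is known,
      \<open>L c\<close> is not. Here \<open>1 - t = 1 / R\<close>, which costs only a factor
      \<open>R\<close>.\<close>
    from borel_caratheodory(2)[OF Lb LM this]
    have "(1 / R) * norm (L c) \<le> 2 * ((R - 1) / R) * M"
      unfolding d1 L1 using R by (simp add: diff_divide_distrib)
    also have "\<dots> \<le> 2 * 1 * M"
      using R M0 by (intro mult_right_mono mult_left_mono) auto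
    finally have Lc: "norm (L c) \<le> 2 * R * M" using R by (simp add: field_simps)
    \<comment> \<open>As \<open>2 * R * Re s >= R\<close> and \<open>(norm s)^2 <= R / 2\<close>,
      the squared distance is at most \<open>R^2 - R / 2\<close>. So \<open>s\<close> keeps distance
      1/4 from the boundary.\<close>
    have ds: "dist c s \<le> R - 1 / 4"
    proof (rule power2_le_imp_le)
      have "(dist c s)\<^sup>2 = R\<^sup>2 - 2 * R * Re s + (norm s)\<^sup>2"
        unfolding dist_norm cmod_power2 c_def by (simp add: power2_eq_square algebra_simps)
      moreover have "2 * R * (1/2) \<le> 2 * R * Re s" using s R by (intro mult_left_mono) auto
      moreover have "(norm s)\<^sup>2 \<le> x\<^sup>2" unfolding x_def by (intro power_mono) auto
      moreover have "x\<^sup>2 = R / 2" by (simp add: R_def)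
      ultimately have "(dist c s)\<^sup>2 \<le> R\<^sup>2 - R / 2" by linarith
      also have "\<dots> \<le> (R - 1 / 4)\<^sup>2" by (simp add: power2_eq_square algebra_simps)
      finally show "(dist c s)\<^sup>2 \<le> (R - 1 / 4)\<^sup>2" .
    qed (use R in auto)
    hence sb: "s \<in> ball c R" by simp
    have "1 / (4 * R) * norm (L s - L c) \<le> (1 - dist c s / R) * norm (L s - L c)"
      using ds R by (intro mult_right_mono) (auto simp: field_simps)
    also have "\<dots> \<le> 2 * (dist c s / R) * (M - Re (L c))"
      by (rule borel_caratheodory(1)[OF Lb LM sb])
    also have "\<dots> \<le> 2 * 1 * (M - Re (L c))"
      using ds R LM[of c] by (intro mult_right_mono mult_left_mono) auto
    also have "\<dots> \<le> 2 * (M + 2 * R * M)"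
      using order_trans[OF abs_Re_le_cmod Lc] by (simp add: abs_le_iff mult_ac)
    finally have "norm (L s - L c) \<le> 8 * R * (M + 2 * R * M)" using R by (simp add: field_simps)
    hence "norm (L s) \<le> 2 * R * M + 8 * R * (M + 2 * R * M)"
      using norm_triangle_ineq[of "L s - L c" "L c"] Lc by simp
    also have "\<dots> = (10 * R + 16 * R * R) * M" by (simp add: algebra_simps)
    \<comment> \<open>With \<open>R = 2 * x^2\<close> the first factor is
      \<open>20 * x^2 + 64 * x^4\<close>, and \<open>1 + 2 * R <= 5 * x^2\<close>.\<close>
    also have "\<dots> \<le> (84 * x ^ 4) * ((A * 5 ^ m + 1) * x ^ (2 * m))"
    proof (intro mult_mono)
      have "x\<^sup>2 \<le> x ^ 4" using x by (intro power_increasing) auto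
      moreover have "16 * R * R = 64 * x ^ 4"
        by (simp add: R_def power2_eq_square power4_eq_xxxx)
      moreover have "10 * R = 20 * x\<^sup>2" by (simp add: R_def)
      ultimately show "10 * R + 16 * R * R \<le> 84 * x ^ 4" by linarith
      have "(1 + 2 * R) ^ m \<le> (5 * x\<^sup>2) ^ m"
        using R x2 by (intro power_mono) (auto simp: R_def)
      hence "A * (1 + 2 * R) ^ m \<le> A * (5 ^ m * x ^ (2 * m))"
        using A(1) by (intro mult_left_mono) (auto simp: power_mult_distrib power_mult)
      moreover have "1 \<le> x ^ (2 * m)" using x by (rule one_le_power)
      ultimately show "M \<le> (A * 5 ^ m + 1) * x ^ (2 * m)" by (simp add: M_def algebra_simps)
    qed (use M0 x in auto)
    also have "\<dots> = 84 * (A * 5 ^ m + 1) * x ^ (2 * m + 4)" by (simp add: power_add mult_ac)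
    finally show ?thesis by (simp add: x_def)
  qed
  with that L expL L1 show ?thesis by blast
qed

text \<open>Each use of the equation moves the argument right by 1; once it is in the half-plane,
  further steps leave the product unchanged, so the local formulas glue. With coefficient 1 this is
  periodic continuation.\<close>

lemma extend_left:
  assumes a: "a holomorphic_on UNIV" and g: "g holomorphic_on right_of c"
    and eq: "\<And>s. Re s > c \<Longrightarrow> g s = a s * g (s + 1)"
  obtains G where "G holomorphic_on UNIV"
    "\<And>s n. c < Re s + real n \<Longrightarrow> G s = (\<Prod>k<n. a (s + of_nat k)) * g (s + of_nat n)"
proof -
  define E where "E = (\<lambda>n s. (\<Prod>k<n. a (s + of_nat k)) * g (s + of_nat n))"
  have E_Suc: "E (Suc n) s = E n s" if "c < Re s + real n" for n s
    using eq[of "s + of_nat n"] that by (simp add: E_def add_ac)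
  have E_le: "E m s = E n s" if "c < Re s + real n" "n \<le> m" for m n s
    using that(2) by (induction m rule: dec_induct) (use that(1) E_Suc in auto)
  have E_eq: "E m s = E n s" if "c < Re s + real n" "c < Re s + real m" for m n s
    using E_le[of s n m] E_le[of s m n] that by (cases "n \<le> m") auto
  define N where "N = (\<lambda>s. nat (\<lceil>c - Re s\<rceil> + 1))"
  have N: "c < Re s + real (N s)" for s unfolding N_def by linarith
  define G where "G = (\<lambda>s. E (N s) s)"
  have G: "G s = E n s" if "c < Re s + real n" for n s
    unfolding G_def by (rule E_eq[OF that N])
  have hol_n: "G holomorphic_on right_of (c - real n)" for n
  proof -
    have "E n holomorphic_on right_of (c - real n)" unfolding E_def
      by (intro holomorphic_intros holomorphic_on_compose_gen[OF _ g, unfolded o_def]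
           holomorphic_on_compose_gen[OF _ a, unfolded o_def]) auto
    thus ?thesis by (rule holomorphic_transform) (use G[of _ n] in auto)
  qed
  have "G holomorphic_on (\<Union>n. right_of (c - real n))"
    by (intro holomorphic_on_UN_open hol_n open_right_of)
  also have "(\<Union>n. right_of (c - real n)) = UNIV"
    using N by (auto simp: set_eq_iff diff_less_eq)
  finally show ?thesis using that G by (simp add: E_def)
qed

lemma finite_order_difference_equation:
  assumes a: "entire_finite_order a" "a 1 = 1" "\<And>s. Re s > 0 \<Longrightarrow> a s \<noteq> 0" and real: "real_analytic_fun a"
  obtains G where "entire_finite_order G" "G 1 = 1" "\<And>s. Re s > 0 \<Longrightarrow> G s \<noteq> 0" "real_analytic_fun G"
    "\<And>s. G s = a s * G (s + 1)"
proof -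
  obtain A m where A: "A \<ge> 0" "\<And>s. norm (a s) \<le> exp (A * (1 + norm s) ^ m)" and hol: "a holomorphic_on UNIV"
    using a(1) by (rule entire_finite_orderE) blast
  obtain L C0 n0 where L: "L holomorphic_on right_of 0" "\<And>s. Re s > 0 \<Longrightarrow> exp (L s) = a s" "L 1 = 0"
    "\<And>s. Re s \<ge> 1/2 \<Longrightarrow> norm (L s) \<le> C0 * (1 + norm s) ^ n0"
    by (rule log_poly_growth[OF a]) (assumption, (rule that; assumption))
  have L': "(\<lambda>s. cnj (L (cnj s))) holomorphic_on right_of 0"
    by (rule holomorphic_on_cnj_conj[OF L(1) open_right_of]) simp
  \<comment> \<open>The difference has exponential 1 because \<open>a\<close> is real, so its
    derivative vanishes; its value at 1 is 0 since \<open>L 1 = 0\<close>.\<close>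
  have "\<exists>k. \<forall>s\<in>right_of 0. L s - cnj (L (cnj s)) = k"
  proof (rule has_field_derivative_zero_constant[OF convex_right_of])
    fix s assume s: "s \<in> right_of 0"
    define D where "D = (\<lambda>s. L s - cnj (L (cnj s)))"
    have expD: "exp (D s) = 1" if "s \<in> right_of 0" for s
    proof -
      have "exp (cnj (L (cnj s))) = a s"
        using L(2)[of "cnj s"] that real by (simp add: exp_cnj[symmetric] real_analytic_fun_def)
      thus ?thesis using L(2)[of s] a(3)[of s] that by (simp add: D_def exp_diff)
    qed
    have D: "(D has_field_derivative deriv D s) (at s)"
      unfolding D_def by (rule holomorphic_derivI[OF _ open_right_of s]) (intro holomorphic_intros L L')
    have "((\<lambda>s. exp (D s)) has_field_derivative exp (D s) * deriv D s) (at s)"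
      by (rule DERIV_fun_exp[OF D])
    moreover have "((\<lambda>s. exp (D s)) has_field_derivative 0) (at s)"
    proof (rule has_field_derivative_transform_within_open[OF DERIV_const open_right_of s])
      show "1 = exp (D x)" if "x \<in> right_of 0" for x using expD[OF that] by simp
    qed
    ultimately have "exp (D s) * deriv D s = 0" by (rule DERIV_unique)
    hence "deriv D s = 0" by simp
    with D show "((\<lambda>s. L s - cnj (L (cnj s))) has_field_derivative 0) (at s within right_of 0)"
      by (simp add: D_def has_field_derivative_at_within)
  qed
  then obtain k where k: "\<And>s. s \<in> right_of 0 \<Longrightarrow> L s - cnj (L (cnj s)) = k" by blast
  have "k = 0" using k[of 1] L(3) by simp
  hence L_real: "cnj (L (cnj s)) = L s" if "Re s > 0" for s using k[of s] that by simp
  obtain F C n where F: "F holomorphic_on right_of 1"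
    "\<And>s. s \<in> right_of 1 \<Longrightarrow> norm (F s) \<le> C * (1 + norm s) ^ n"
    "\<And>s. s \<in> right_of 1 \<Longrightarrow> F (s + 1) - F s = L s"
    using diff_solvable_of_poly_growth[OF L(1) L(4)] unfolding diff_solvable_def poly_growth_on_def by blast
  have C: "C \<ge> 0" using order_trans[OF norm_ge_zero F(2)[of 2]] by (auto simp: zero_le_mult_iff power_le_zero_eq)
  \<comment> \<open>Averaging with the conjugate function makes the solution real, and the equation
    survives because \<open>L\<close> is real.\<close>
  define F' where "F' = (\<lambda>s. (F s + cnj (F (cnj s))) / 2)"
  have F'_real: "cnj (F' (cnj s)) = F' s" for s by (simp add: F'_def add.commute)
  have F'_hol: "F' holomorphic_on right_of 1"
    unfolding F'_def by (intro holomorphic_intros holomorphic_on_cnj_conj F open_right_of) auto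
  have F'_bound: "norm (F' s) \<le> C * (1 + norm s) ^ n" if "s \<in> right_of 1" for s
    using norm_triangle_ineq[of "F s" "cnj (F (cnj s))"] F(2)[of s] F(2)[of "cnj s"] that
    by (simp add: F'_def norm_divide)
  have F'_eq: "F' (s + 1) - F' s = L s" if "s \<in> right_of 1" for s
  proof -
    have "F' (s + 1) - F' s = ((F (s + 1) - F s) + cnj (F (cnj s + 1) - F (cnj s))) / 2"
      by (simp add: F'_def field_simps)
    also have "\<dots> = (L s + cnj (L (cnj s))) / 2" using F(3)[of s] F(3)[of "cnj s"] that by simp
    also have "\<dots> = L s" using L_real[of s] that by simp
    finally show ?thesis .
  qed
  define g where "g = (\<lambda>s. exp (- F' s))"
  have g_real: "cnj (g (cnj s)) = g s" for s using F'_real[of s] by (simp add: g_def exp_cnj)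
  have g_hol: "g holomorphic_on right_of 1" unfolding g_def by (intro holomorphic_intros F'_hol)
  have g_eq: "g s = a s * g (s + 1)" if "Re s > 1" for s
  proof -
    have "- F' s = L s + (- F' (s + 1))" using F'_eq[of s] that by (simp add: algebra_simps)
    thus ?thesis using L(2)[of s] that by (simp only: g_def exp_add)
  qed
  obtain G where G: "G holomorphic_on UNIV"
    "\<And>s n. 1 < Re s + real n \<Longrightarrow> G s = (\<Prod>k<n. a (s + of_nat k)) * g (s + of_nat n)"
    by (rule extend_left[OF hol g_hol g_eq]) (assumption, (rule that; assumption))
  \<comment> \<open>At most \<open>norm s + 3\<close> steps lead to \<open>Re s > 1\<close>; this
    linear number of factors turns the exponent \<open>m\<close> of the coefficient into
    \<open>m + 1\<close>.\<close>
  define N where "N = (\<lambda>s. nat \<lceil>\<bar>Re s\<bar>\<rceil> + 2)"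
  have N: "1 < Re s + real (N s)" "real (N s) \<le> norm s + 3" for s
  proof -
    show "1 < Re s + real (N s)" unfolding N_def by linarith
    have "real (N s) \<le> \<bar>Re s\<bar> + 3" unfolding N_def by linarith
    thus "real (N s) \<le> norm s + 3" using abs_Re_le_cmod[of s] by simp
  qed
  have G_order: "entire_finite_order G"
  proof (rule entire_finite_orderI[OF G(1), where A = "3 * A * 4 ^ m + C * 4 ^ n" and n = "max (Suc m) n"])
    fix s :: complex
    define x where "x = 1 + norm s"
    have x: "x \<ge> 1" by (simp add: x_def)
    have "norm s + 3 \<le> 3 * x" by (simp add: x_def)
    hence N3: "real (N s) \<le> 3 * x" by (rule order_trans[OF N(2)])
    have shift: "1 + norm (s + of_nat k) \<le> 4 * x" if "k \<le> N s" for k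
    proof -
      have "norm (s + of_nat k) \<le> norm s + real k" using norm_triangle_ineq[of s "of_nat k"] by simp
      moreover have "real k \<le> norm s + 3" using that N(2)[of s] by linarith
      ultimately have "norm (s + of_nat k) \<le> 2 * norm s + 3" by simp
      also have "\<dots> \<le> 4 * norm s + 3" by simp
      finally show ?thesis by (simp add: x_def)
    qed
    have "norm (\<Prod>k<N s. a (s + of_nat k)) \<le> (\<Prod>k<N s. exp (A * (4 * x) ^ m))"
      unfolding prod_norm[symmetric]
    proof (intro prod_mono conjI norm_ge_zero)
      fix k assume k: "k \<in> {..<N s}"
      have "A * (1 + norm (s + of_nat k)) ^ m \<le> A * (4 * x) ^ m"
        using A(1) shift[of k] k by (intro mult_left_mono power_mono) auto
      thus "norm (a (s + of_nat k)) \<le> exp (A * (4 * x) ^ m)"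
        using A(2)[of "s + of_nat k"] by (meson exp_le_cancel_iff order_trans)
    qed
    also have "\<dots> = exp (real (N s) * (A * (4 * x) ^ m))" by (simp add: exp_of_nat_mult)
    also have "\<dots> \<le> exp (3 * x * (A * (4 * x) ^ m))"
      using A(1) x N3 by (intro exp_le_cancel_iff[THEN iffD2] mult_right_mono) auto
    finally have 1: "norm (\<Prod>k<N s. a (s + of_nat k)) \<le> exp (3 * x * (A * (4 * x) ^ m))" .
    have "norm (F' (s + of_nat (N s))) \<le> C * (1 + norm (s + of_nat (N s))) ^ n"
      using N(1)[of s] by (intro F'_bound) simp
    also have "\<dots> \<le> C * (4 * x) ^ n"
      using C shift[of "N s"] by (intro mult_left_mono power_mono) auto
    finally have 2: "norm (g (s + of_nat (N s))) \<le> exp (C * (4 * x) ^ n)"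
      using abs_Re_le_cmod[of "F' (s + of_nat (N s))"] by (simp add: g_def)
    have "norm (G s) \<le> exp (3 * x * (A * (4 * x) ^ m)) * exp (C * (4 * x) ^ n)"
      unfolding G(2)[OF N(1)] norm_mult using 1 2 by (intro mult_mono) auto
    also have "\<dots> = exp (3 * A * 4 ^ m * x ^ Suc m + C * 4 ^ n * x ^ n)"
      by (simp add: exp_add[symmetric] power_mult_distrib mult_ac)
    also have "\<dots> \<le> exp (3 * A * 4 ^ m * x ^ max (Suc m) n + C * 4 ^ n * x ^ max (Suc m) n)"
      using A(1) C x by (intro exp_le_cancel_iff[THEN iffD2] add_mono mult_left_mono power_increasing) auto
    finally show "norm (G s) \<le> exp ((3 * A * 4 ^ m + C * 4 ^ n) * (1 + norm s) ^ max (Suc m) n)"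
      by (simp only: distrib_right x_def)
  qed
  have G_eq: "G s = a s * G (s + 1)" for s
  proof -
    have "G s = (\<Prod>k<Suc (N s). a (s + of_nat k)) * g (s + of_nat (Suc (N s)))"
      by (rule G(2)) (use N(1)[of s] in simp)
    also have "\<dots> = a s * ((\<Prod>k<N s. a (s + 1 + of_nat k)) * g (s + 1 + of_nat (N s)))"
      unfolding prod.lessThan_Suc_shift by (simp add: add_ac)
    also have "(\<Prod>k<N s. a (s + 1 + of_nat k)) * g (s + 1 + of_nat (N s)) = G (s + 1)"
      by (rule G(2)[symmetric]) (use N(1)[of s] in simp)
    finally show ?thesis .
  qed
  have a_real: "cnj (a (cnj s + of_nat k)) = a (s + of_nat k)" for s k
    using real[unfolded real_analytic_fun_def, rule_format, of "s + of_nat k"] by simp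
  have G_real: "cnj (G (cnj s)) = G s" for s
    using G(2)[of "cnj s" "N s"] G(2)[of s "N s"] N(1)[of s] g_real[of "s + of_nat (N s)"]
    by (simp add: a_real)
  have G_nz: "G s \<noteq> 0" if "Re s > 0" for s
    using G(2)[of s 1] a(3)[of s] that by (simp add: g_def)
  \<comment> \<open>The equation is homogeneous and \<open>G 1\<close> is real and nonzero, so
    dividing by it preserves everything.\<close>
  show ?thesis
  proof (rule that[of "\<lambda>s. G s * (1 / G 1)"])
    show "entire_finite_order (\<lambda>s. G s * (1 / G 1))"
      by (intro entire_finite_order_mult G_order entire_finite_order_const)
    show "real_analytic_fun (\<lambda>s. G s * (1 / G 1))"
      using G_real G_real[of 1] by (simp add: real_analytic_fun_def)
    show "G s * (1 / G 1) = a s * (G (s + 1) * (1 / G 1))" for s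
      by (subst G_eq) (simp only: mult.assoc)
    show "G s * (1 / G 1) \<noteq> 0" if "Re s > 0" for s
      using G_nz[OF that] G_nz[of 1] by simp
    show "G 1 * (1 / G 1) = 1" using G_nz[of 1] by simp
  qed
qed

section \<open>Uniqueness\<close>

text \<open>Periodicity reduces the polynomial exponent to \<open>P 0 + \<kappa> * z\<close> with
  \<open>exp \<kappa> = 1\<close>. Reality excludes functions such as
  \<open>exp (2 * pi * i * s)\<close>.\<close>

lemma periodic_finite_order_eq_1:
  assumes Q: "entire_finite_order Q" "\<And>s. Q s \<noteq> 0" "\<And>s. Q (s + 1) = Q s" "Q 1 = 1"
    and real: "real_analytic_fun Q"
  shows "Q s = 1"
proof -
  obtain A n where A: "A \<ge> 0" "\<And>s. norm (Q s) \<le> exp (A * (1 + norm s) ^ n)" and hol: "Q holomorphic_on UNIV"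
    using Q(1) by (rule entire_finite_orderE) blast
  obtain P where P: "P holomorphic_on UNIV" "\<And>s. exp (P s) = Q s"
    using holomorphic_logarithm_exists[OF convex_UNIV open_UNIV hol, of 0] Q(2) by auto
  have ReP: "Re (P s) \<le> A * (1 + norm s) ^ n" for s
    using A(2)[of s] P(2)[of s] by (metis exp_le_cancel_iff norm_exp_eq_Re)
  define C where "C = norm (P 0) + 2 * (A * 5 ^ n + 1 + norm (P 0))"
  have P_bound: "norm (P s) \<le> C * norm s ^ n" if s: "1 \<le> norm s" for s
  proof -
    define r where "r = norm s"
    have r: "r \<ge> 1" using s by (simp add: r_def)
    have rn: "r ^ n \<ge> 1" using r by (rule one_le_power)
    have le: "Re (P z) < A * (5 * r) ^ n + 1" if "z \<in> ball 0 (2 * r)" for z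
    proof -
      have "A * (1 + norm z) ^ n \<le> A * (5 * r) ^ n"
        using A(1) that r by (intro mult_left_mono power_mono) auto
      thus ?thesis using ReP[of z] by linarith
    qed
    have sb: "s \<in> ball 0 (2 * r)" using r unfolding mem_ball_0 r_def[symmetric] by simp
    have t: "dist 0 s / (2 * r) = 1 / 2" using r by (simp add: r_def[symmetric])
    have "(1 - dist 0 s / (2 * r)) * norm (P s - P 0)
            \<le> 2 * (dist 0 s / (2 * r)) * (A * (5 * r) ^ n + 1 - Re (P 0))"
      by (rule borel_caratheodory(1)[OF holomorphic_on_subset[OF P(1)] le sb]) auto
    hence "norm (P s - P 0) \<le> 2 * (A * (5 * r) ^ n + 1 - Re (P 0))" unfolding t by simp
    also have "\<dots> \<le> 2 * (A * 5 ^ n * r ^ n + 1 + norm (P 0))"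
      using abs_Re_le_cmod[of "P 0"] by (simp add: abs_le_iff power_mult_distrib)
    finally have "norm (P s) \<le> norm (P 0) + 2 * (A * 5 ^ n * r ^ n + 1 + norm (P 0))"
      using norm_triangle_ineq[of "P s - P 0" "P 0"] by simp
    also have "\<dots> \<le> norm (P 0) * r ^ n + 2 * (A * 5 ^ n * r ^ n + 1 * r ^ n + norm (P 0) * r ^ n)"
      using A(1) rn mult_left_mono[OF rn, of "norm (P 0)"] by (intro add_mono mult_left_mono) auto
    also have "\<dots> = C * r ^ n" by (simp add: C_def algebra_simps)
    finally show ?thesis by (simp add: r_def)
  qed
  have P_poly: "P z = (\<Sum>k\<le>n. (deriv^^k) P 0 / fact k * z ^ k)" for z
    by (rule Liouville_polynomial[OF P(1) P_bound])
  have "\<exists>\<kappa>. \<forall>s\<in>UNIV. P (s + 1) - P s = \<kappa>"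
  proof (rule has_field_derivative_zero_constant[OF convex_UNIV])
    fix s :: complex
    define D where "D = (\<lambda>s. P (s + 1) - P s)"
    have expD: "exp (D s) = 1" for s
      using Q(2)[of s] Q(3)[of s] by (simp add: D_def exp_diff P(2))
    have "(\<lambda>s. P (s + 1)) holomorphic_on UNIV"
      by (intro holomorphic_on_compose_gen[OF _ P(1), unfolded o_def] holomorphic_intros) auto
    hence D: "(D has_field_derivative deriv D s) (at s)"
      unfolding D_def by (intro holomorphic_derivI[of _ UNIV] holomorphic_intros P) auto
    have "((\<lambda>s. exp (D s)) has_field_derivative exp (D s) * deriv D s) (at s)"
      by (rule DERIV_fun_exp[OF D])
    moreover have "((\<lambda>s. exp (D s)) has_field_derivative 0) (at s)"
      unfolding expD by (rule DERIV_const)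
    ultimately have "exp (D s) * deriv D s = 0" by (rule DERIV_unique)
    hence "deriv D s = 0" by simp
    with D show "((\<lambda>s. P (s + 1) - P s) has_field_derivative 0) (at s within UNIV)"
      by (simp add: D_def)
  qed
  then obtain \<kappa> where \<kappa>: "\<And>s. P (s + 1) - P s = \<kappa>" by blast
  \<comment> \<open>This is \<open>P z - P 0 - \<kappa> * z\<close> as a formal polynomial; it
    vanishes at all natural numbers, hence identically.\<close>
  define p where "p = (\<Sum>k\<le>n. monom ((deriv^^k) P 0 / fact k) k) - [:P 0, \<kappa>:]"
  have poly_p: "poly p z = P z - P 0 - \<kappa> * z" for z
    unfolding p_def P_poly[of z] by (simp add: poly_sum poly_monom algebra_simps)
  have "poly p (of_nat m) = 0" for m
  proof (induction m)
    case (Suc m)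
    thus ?case using \<kappa>[of "of_nat m"] by (simp add: poly_p algebra_simps)
  qed (simp add: poly_p)
  hence "range of_nat \<subseteq> {z. poly p z = 0}" by auto
  moreover have "infinite (range (of_nat :: nat \<Rightarrow> complex))"
    by (rule range_inj_infinite) (simp add: inj_of_nat)
  ultimately have "p = 0" using poly_roots_finite[of p] finite_subset by blast
  hence P_lin: "P z = P 0 + \<kappa> * z" for z using poly_p[of z] by (simp add: algebra_simps)
  have Q_eq: "Q z = exp (P 0) * exp (\<kappa> * z)" for z
    using P(2)[of z] P_lin[of z] by (simp add: exp_add)
  have "cnj \<kappa> = \<kappa>"
  proof (rule ccontr)
    assume "cnj \<kappa> \<noteq> \<kappa>"
    \<comment> \<open>At the point \<open>1 / d\<close> the two exponents differ by exactly 1, which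
      forces \<open>exp 1 = 1\<close>.\<close>
    define d where "d = cnj \<kappa> - \<kappa>"
    have d: "d \<noteq> 0" using \<open>cnj \<kappa> \<noteq> \<kappa>\<close> by (simp add: d_def)
    have eq: "exp (cnj (P 0)) * exp (cnj \<kappa> * z) = exp (P 0) * exp (\<kappa> * z)" for z
    proof -
      have "cnj (Q (cnj z)) = Q z" using real by (simp add: real_analytic_fun_def)
      thus ?thesis unfolding Q_eq by (simp add: exp_cnj)
    qed
    have "exp (cnj \<kappa> * (1 / d)) = exp (\<kappa> * (1 / d))"
      using eq[of "1 / d"] eq[of 0] by simp
    hence "exp (cnj \<kappa> * (1 / d) - \<kappa> * (1 / d)) = 1" by (simp add: exp_diff)
    moreover have "cnj \<kappa> * (1 / d) - \<kappa> * (1 / d) = 1" using d by (simp add: d_def diff_divide_distrib[symmetric])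
    ultimately have "exp (1 :: complex) = 1" by simp
    hence "norm (exp (1 :: complex)) = 1" by simp
    thus False by (simp add: norm_exp_eq_Re)
  qed
  hence "Im \<kappa> = 0" by (simp add: complex_eq_iff)
  moreover have "Re \<kappa> = 0"
  proof -
    have "exp \<kappa> = 1" using Q_eq[of 1] Q_eq[of 0] Q(3)[of 0] by simp
    hence "exp (Re \<kappa>) = 1" by (metis norm_exp_eq_Re norm_one)
    thus ?thesis by simp
  qed
  ultimately have "\<kappa> = 0" by (simp add: complex_eq_iff)
  thus ?thesis using Q_eq[of s] Q_eq[of 1] Q(4) by simp
qed

section \<open>Canonical representatives and equality off discrete sets\<close>

lemma nicely_meromorphic_LLD_right:
  assumes "g nicely_meromorphic_on UNIV" "LLD g" "Re s > 0"
  shows "g analytic_on {s}" "g s \<noteq> 0"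
proof -
  have s: "s \<notin> mero_zeros g" "s \<notin> mero_poles g" using assms(2,3) by (force simp: LLD_def)+
  hence np: "\<not> is_pole g s" by (simp add: mero_poles_def)
  thus "g analytic_on {s}" using nicely_meromorphic_on_imp_analytic_at[OF assms(1)] by blast
  have "g \<midarrow>s\<rightarrow> g s" using assms(1) np by (auto simp: nicely_meromorphic_on_def)
  thus "g s \<noteq> 0" using s(1) np by (auto simp: mero_zeros_def)
qed

text \<open>At a pole a nicely meromorphic function has the value 0, which is also what
  \<open>remove_sings\<close> returns there.\<close>

lemma nicely_meromorphic_remove_sings:
  assumes "g nicely_meromorphic_on UNIV"
  shows "remove_sings g = g"
proof
  fix z
  have "is_pole g z \<and> g z = 0 \<or> g \<midarrow>z\<rightarrow> g z" using assms by (auto simp: nicely_meromorphic_on_def)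
  thus "remove_sings g z = g z" by auto
qed

text \<open>This turns equality off a discrete set into equality of functions, so that the family
  can be literally unique.\<close>

lemma nicely_meromorphic_eqI:
  assumes "g nicely_meromorphic_on UNIV" "h nicely_meromorphic_on UNIV" "\<forall>\<^sub>\<approx>s. g s = h s"
  shows "g = h"
proof
  fix z
  have "eventually (\<lambda>s. g s = h s) (at z)"
    using eventually_cosparse_imp_eventually_at[OF assms(3), of z UNIV] by simp
  hence "remove_sings g z = remove_sings h z" by (rule remove_sings_cong) simp
  thus "g z = h z" using assms by (simp add: nicely_meromorphic_remove_sings)
qed

lemma cosparse_eq_imp_eq:
  assumes "\<forall>\<^sub>\<approx>s. g s = h s" "g analytic_on {z}" "h analytic_on {z}"
  shows "g z = h z"
proof -
  have ev: "eventually (\<lambda>s. g s = h s) (at z)"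
    using eventually_cosparse_imp_eventually_at[OF assms(1), of z UNIV] by simp
  have "g \<midarrow>z\<rightarrow> g z" "h \<midarrow>z\<rightarrow> h z"
    using assms(2,3) by (auto intro!: isContD analytic_at_imp_isCont)
  moreover from this(2) have "g \<midarrow>z\<rightarrow> h z" using tendsto_cong[OF ev] by simp
  ultimately show ?thesis using tendsto_unique by (metis trivial_limit_at)
qed

lemma entire_nonzero_cosparse:
  assumes "g holomorphic_on UNIV" "g p \<noteq> 0"
  shows "\<forall>\<^sub>\<approx>s. g s \<noteq> 0"
proof -
  have "g nicely_meromorphic_on UNIV"
    using assms(1) by (intro analytic_on_imp_nicely_meromorphic_on) (simp add: analytic_on_open)
  from nicely_meromorphic_imp_constant_or_avoid[OF this open_UNIV connected_UNIV, of 0]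
  show ?thesis using assms(2) by auto
qed

lemma cosparse_ex:
  assumes "\<forall>\<^sub>\<approx>s. P (s :: complex)"
  shows "\<exists>s. P s"
  using eventually_happens[OF assms] by simp

lemma mero_finite_orderE:
  assumes "mero_finite_order g" "g analytic_on {p}" "g p \<noteq> 0"
  obtains a b where "entire_finite_order a" "entire_finite_order b" "\<forall>\<^sub>\<approx>s. a s \<noteq> 0" "\<forall>\<^sub>\<approx>s. b s \<noteq> 0"
    "\<forall>\<^sub>\<approx>s. g s = a s / b s" "a holomorphic_on UNIV" "b holomorphic_on UNIV"
proof -
  obtain a b q where ab: "entire_finite_order a" "entire_finite_order b" "b q \<noteq> 0" "\<forall>\<^sub>\<approx>s. g s = a s / b s"
    using assms(1) by (auto simp: mero_finite_order_def)
  have hol: "a holomorphic_on UNIV" "b holomorphic_on UNIV"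
    using ab by (auto simp: entire_finite_order_def)
  have "\<exists>s. a s \<noteq> 0"
  proof (rule ccontr)
    assume "\<not> (\<exists>s. a s \<noteq> 0)"
    hence "\<forall>\<^sub>\<approx>s. g s = 0" using ab(4) by simp
    from cosparse_eq_imp_eq[OF this assms(2)] assms(3) show False by simp
  qed
  then obtain r where "a r \<noteq> 0" by blast
  with entire_nonzero_cosparse[OF hol(1)] entire_nonzero_cosparse[OF hol(2) ab(3)] that ab hol
  show ?thesis by blast
qed

text \<open>Cross-multiplying the representations of \<open>g1\<close> and \<open>g2\<close> gives
  entire \<open>A\<close>, \<open>B\<close> of finite order with \<open>g1 / g2 = A / B\<close>. The
  periodic continuation of this quotient is entire and inherits finite order by the division
  theorem.\<close>

lemma difference_equation_unique:
  assumes g1: "g1 nicely_meromorphic_on UNIV" "mero_finite_order g1" "LLD g1" "real_analytic_fun g1" "g1 1 = 1"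
    and g2: "g2 nicely_meromorphic_on UNIV" "mero_finite_order g2" "LLD g2" "real_analytic_fun g2" "g2 1 = 1"
    and h: "\<forall>\<^sub>\<approx>s. h s \<noteq> 0"
    and eq1: "\<forall>\<^sub>\<approx>s. g1 (s + 1) = inverse (h s) * g1 s"
    and eq2: "\<forall>\<^sub>\<approx>s. g2 (s + 1) = inverse (h s) * g2 s"
  shows "g1 = g2"
proof -
  note reg1 = nicely_meromorphic_LLD_right[OF g1(1,3)] and reg2 = nicely_meromorphic_LLD_right[OF g2(1,3)]
  obtain a1 b1 where ab1: "entire_finite_order a1" "entire_finite_order b1" "\<forall>\<^sub>\<approx>s. a1 s \<noteq> 0" "\<forall>\<^sub>\<approx>s. b1 s \<noteq> 0"
    "\<forall>\<^sub>\<approx>s. g1 s = a1 s / b1 s" "a1 holomorphic_on UNIV" "b1 holomorphic_on UNIV"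
    by (rule mero_finite_orderE[OF g1(2), of 1]) (use reg1[of 1] g1(5) in auto)
  obtain a2 b2 where ab2: "entire_finite_order a2" "entire_finite_order b2" "\<forall>\<^sub>\<approx>s. a2 s \<noteq> 0" "\<forall>\<^sub>\<approx>s. b2 s \<noteq> 0"
    "\<forall>\<^sub>\<approx>s. g2 s = a2 s / b2 s" "a2 holomorphic_on UNIV" "b2 holomorphic_on UNIV"
    by (rule mero_finite_orderE[OF g2(2), of 1]) (use reg2[of 1] g2(5) in auto)
  define A where "A = (\<lambda>s. a1 s * b2 s)"
  define B where "B = (\<lambda>s. b1 s * a2 s)"
  have A: "entire_finite_order A" "A holomorphic_on UNIV"
    unfolding A_def using ab1 ab2 by (auto intro!: entire_finite_order_mult holomorphic_intros)
  have B: "entire_finite_order B" "B holomorphic_on UNIV"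
    unfolding B_def using ab1 ab2 by (auto intro!: entire_finite_order_mult holomorphic_intros)
  have Bnz: "\<forall>\<^sub>\<approx>s. B s \<noteq> 0"
    using ab1(4) ab2(3) by eventually_elim (simp add: B_def)
  then obtain p where p: "B p \<noteq> 0" using cosparse_ex by blast
  define q where "q = (\<lambda>s. g1 s / g2 s)"
  have q_ana: "q analytic_on {s}" and q_nz: "q s \<noteq> 0" if "Re s > 0" for s
    unfolding q_def using reg1[OF that] reg2[OF that] by (auto intro!: analytic_intros)
  have q_hol: "q holomorphic_on right_of 0"
    using q_ana by (metis (mono_tags, lifting) analytic_imp_holomorphic analytic_on_analytic_at mem_Collect_eq)
  have "\<forall>\<^sub>\<approx>s. q s * B s = A s"
    using ab1(3,4,5) ab2(3,4,5) by eventually_elim (simp add: q_def A_def B_def)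
  hence qB: "q s * B s = A s" if "Re s > 0" for s
    by (rule cosparse_eq_imp_eq)
       (use q_ana[OF that] A B in \<open>auto intro!: analytic_intros holomorphic_on_imp_analytic_at\<close>)
  have "\<forall>\<^sub>\<approx>s. q s = q (s + 1)"
    using h eq1 eq2 by eventually_elim (simp add: q_def)
  hence q_per: "q s = 1 * q (s + 1)" if "Re s > 0" for s
  proof (subst mult_1, rule cosparse_eq_imp_eq)
    have "q \<circ> (\<lambda>s. s + 1) analytic_on {s}"
      using that by (intro analytic_on_compose_gen[OF _ analytic_on_analytic_at[THEN iffD2], of _ _ "right_of 0"] ballI q_ana)
         (auto intro!: analytic_intros)
    thus "(\<lambda>s. q (s + 1)) analytic_on {s}" by (simp add: o_def)
  qed (use q_ana that in auto)
  \<comment> \<open>Periodicity, written with coefficient 1, is an instance of the equation treated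
    by \<open>extend_left\<close>.\<close>
  obtain Q where Q: "Q holomorphic_on UNIV"
    "\<And>s n. 0 < Re s + real n \<Longrightarrow> Q s = (\<Prod>k<n. 1) * q (s + of_nat n)"
    by (rule extend_left[OF holomorphic_on_const q_hol q_per]) (assumption, (rule that; assumption))
  have Q': "Q s = q (s + of_nat n)" if "0 < Re s + real n" for s n using Q(2)[OF that] by simp
  define N where "N = (\<lambda>s. nat \<lceil>\<bar>Re s\<bar>\<rceil> + 1)"
  have N: "0 < Re s + real (N s)" for s unfolding N_def by linarith
  have QB: "Q s * B s = A s" for s
  proof (rule analytic_continuation_open[where f = "\<lambda>s. Q s * B s" and g = A and s = "right_of 0" and s' = UNIV])
    show "right_of 0 \<noteq> {}" by (metis (mono_tags) empty_iff mem_Collect_eq one_complex.simps(1) zero_less_one)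
    show "Q z * B z = A z" if "z \<in> right_of 0" for z
      using Q'[of z 0] qB[of z] that by simp
  qed (use Q A B open_right_of in \<open>auto intro!: holomorphic_intros\<close>)
  have "Q s = 1" for s
  proof (rule periodic_finite_order_eq_1[where Q = Q])
    have "(\<lambda>s. Q s * B s) = A" using QB by auto
    thus "entire_finite_order Q" using entire_finite_order_quotient[OF Q(1) B(1) p] A by simp
    show "Q s \<noteq> 0" for s using Q'[OF N] q_nz N[of s] by simp
    show "Q (s + 1) = Q s" for s
      using Q'[of "s + 1" "N s"] Q'[of s "Suc (N s)"] N[of s] by (simp add: add_ac)
    show "Q 1 = 1" using Q'[of 1 0] g1 g2 by (simp add: q_def)
    have q_real: "cnj (q (cnj s)) = q s" for s
      using g1(4) g2(4) by (simp add: q_def real_analytic_fun_def)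
    have "cnj (Q (cnj s)) = Q s" for s
      using Q'[of "cnj s" "N s"] Q'[OF N[of s]] q_real[of "s + of_nat (N s)"] N[of s] by simp
    thus "real_analytic_fun Q" by (simp add: real_analytic_fun_def)
  qed
  hence "A s = B s" for s using QB[of s] by simp
  hence "\<forall>\<^sub>\<approx>s. A s = B s" by simp
  hence "\<forall>\<^sub>\<approx>s. g1 s = g2 s"
    using ab1(4,5) ab2(4,5) by eventually_elim (simp add: A_def B_def frac_eq_eq mult_ac)
  thus ?thesis by (rule nicely_meromorphic_eqI[OF g1(1) g2(1)])
qed

section \<open>The family of Gamma functions\<close>

definition admissible :: "(complex \<Rightarrow> complex) \<Rightarrow> bool" where
  "admissible a \<longleftrightarrow> entire_finite_order a \<and> a 1 = 1 \<and> (\<forall>s. Re s > 0 \<longrightarrow> a s \<noteq> 0) \<and> real_analytic_fun a"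

lemma admissible_holomorphic: "admissible a \<Longrightarrow> a holomorphic_on UNIV"
  by (simp add: admissible_def entire_finite_order_def)

lemma admissible_nonzero_cosparse: "admissible a \<Longrightarrow> \<forall>\<^sub>\<approx>s. a s \<noteq> 0"
  using entire_nonzero_cosparse[OF admissible_holomorphic, of a 1] by (simp add: admissible_def)

lemma exists_admissible_step:
  assumes "admissible a"
  shows "\<exists>G. admissible G \<and> (\<forall>s. G s = a s * G (s + 1))"
proof -
  have a: "entire_finite_order a" "a 1 = 1" "\<And>s. Re s > 0 \<Longrightarrow> a s \<noteq> 0" "real_analytic_fun a"
    using assms by (auto simp: admissible_def)
  obtain G where "entire_finite_order G" "G 1 = 1" "\<And>s. Re s > 0 \<Longrightarrow> G s \<noteq> 0" "real_analytic_fun G"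
    "\<And>s. G s = a s * G (s + 1)"
    by (rule finite_order_difference_equation[OF a]) (assumption, (rule that; assumption))
  hence "admissible G" "\<forall>s. G s = a s * G (s + 1)" unfolding admissible_def by metis+
  thus ?thesis by blast
qed

text \<open>The constant places the zeros \<open>-1 + 2 * pi * i * k\<close>, infinitely many, in
  \<open>Re s <= 0\<close>.\<close>

lemma exp_minus_const_finite_order: "entire_finite_order (\<lambda>s. exp s - exp (- 1))"
proof (rule entire_finite_orderI[where A = 1 and n = 1])
  fix s :: complex
  have "norm (exp s - exp (- 1)) \<le> norm (exp s) + norm (exp (- 1 :: complex))" by (rule norm_triangle_ineq4)
  also have "\<dots> \<le> exp (norm s) + exp (norm s)"
    unfolding norm_exp_eq_Re
    by (intro add_mono exp_le_cancel_iff[THEN iffD2] complex_Re_le_cmod)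
       (simp add: order_trans[OF _ norm_ge_zero])
  also have "\<dots> \<le> exp 1 * exp (norm s)"
    using exp_ge_add_one_self[of "1 :: real"] mult_right_mono[of 2 "exp 1" "exp (norm s)"] by simp
  also have "\<dots> = exp (1 * (1 + norm s) ^ 1)" by (simp add: exp_add)
  finally show "norm (exp s - exp (- 1)) \<le> exp (1 * (1 + norm s) ^ 1)" .
qed (intro holomorphic_intros)

lemma infinite_zeros_exp_minus_const: "infinite {s. Re s \<le> 0 \<and> exp s - exp (- 1) = (0 :: complex)}"
proof -
  define z where "z = (\<lambda>k::nat. Complex (- 1) (2 * pi * real k))"
  have "exp (z k) = exp (- 1)" for k
    unfolding exp_eq by (intro exI[of _ "int k"]) (simp add: z_def complex_eq_iff)
  hence "range z \<subseteq> {s. Re s \<le> 0 \<and> exp s - exp (- 1) = 0}" by (auto simp: z_def)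
  moreover have "infinite (range z)"
    by (rule range_inj_infinite) (auto simp: inj_def z_def)
  ultimately show ?thesis using finite_subset by blast
qed

text \<open>Common zeros of numerator and denominator in the right half-plane are removed by
  replacing the denominator by the canonical product over its zeros in \<open>Re s \<le> 0\<close>. The auxiliary
  factor \<open>exp s - exp (-1)\<close> only serves to make that zero set infinite, and multiplying by the
  conjugate function makes numerator and denominator real.\<close>
lemma admissible_quotient:
  assumes f: "f nicely_meromorphic_on UNIV" "mero_finite_order f" "LLD f" "real_analytic_fun f" "f 1 = 1"
  obtains a b where "admissible a" "admissible b" "\<forall>\<^sub>\<approx>s. f s = a s / b s"
proof -
  note reg = nicely_meromorphic_LLD_right[OF f(1,3)]
  obtain g0 k0 where gk0: "entire_finite_order g0" "entire_finite_order k0" "\<forall>\<^sub>\<approx>s. g0 s \<noteq> 0" "\<forall>\<^sub>\<approx>s. k0 s \<noteq> 0"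
    "\<forall>\<^sub>\<approx>s. f s = g0 s / k0 s" "g0 holomorphic_on UNIV" "k0 holomorphic_on UNIV"
    by (rule mero_finite_orderE[OF f(2), of 1]) (use reg[of 1] f(5) in auto)
  define w where "w = (\<lambda>s::complex. exp s - exp (- 1))"
  have w: "entire_finite_order w" unfolding w_def by (rule exp_minus_const_finite_order)
  hence w_hol: "w holomorphic_on UNIV" by (simp add: entire_finite_order_def)
  have "exp (1 :: complex) \<noteq> exp (- 1)"
  proof
    assume "exp (1 :: complex) = exp (- 1)"
    hence "norm (exp (1 :: complex)) = norm (exp (- 1 :: complex))" by simp
    thus False by (simp add: norm_exp_eq_Re)
  qed
  hence wnz: "\<forall>\<^sub>\<approx>s. w s \<noteq> 0" using entire_nonzero_cosparse[OF w_hol, of 1] by (simp add: w_def)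
  define g where "g = (\<lambda>s. g0 s * w s)"
  define k where "k = (\<lambda>s. k0 s * w s)"
  have g: "entire_finite_order g" "g holomorphic_on UNIV" and k: "entire_finite_order k" "k holomorphic_on UNIV"
    unfolding g_def k_def using gk0 w w_hol by (auto intro!: entire_finite_order_mult holomorphic_intros)
  have knz: "\<forall>\<^sub>\<approx>s. k s \<noteq> 0" using gk0(4) wnz by eventually_elim (simp add: k_def)
  have fgk: "\<forall>\<^sub>\<approx>s. f s = g s / k s" using gk0(5) wnz by eventually_elim (simp add: g_def k_def)
  obtain p where p: "k p \<noteq> 0" using cosparse_ex[OF knz] by blast
  define S where "S = {s :: complex. Re s \<le> 0}"
  have inf: "infinite {z \<in> S. k z = 0}"
  proof
    assume "finite {z \<in> S. k z = 0}"
    moreover have "{s. Re s \<le> 0 \<and> exp s - exp (- 1) = (0 :: complex)} \<subseteq> {z \<in> S. k z = 0}"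
      by (auto simp: S_def k_def w_def)
    ultimately show False using infinite_zeros_exp_minus_const finite_subset by blast
  qed
  obtain W where W: "entire_finite_order W" "\<And>z. z \<notin> S \<Longrightarrow> W z \<noteq> 0"
    "\<And>z. z \<in> S \<Longrightarrow> \<exists>c. (\<lambda>s. W s / k s) \<midarrow>z\<rightarrow> c"
    by (rule exists_finite_order_with_zeros[OF k(1) p inf]) (rule that; assumption)
  have W_hol: "W holomorphic_on UNIV" using W(1) by (simp add: entire_finite_order_def)
  have W_nz: "W s \<noteq> 0" if "Re s > 0" for s using W(2)[of s] that by (simp add: S_def)
  have at_lim: "h \<midarrow>z\<rightarrow> h z" if "h holomorphic_on UNIV" for h :: "complex \<Rightarrow> complex" and z
    using that by (intro isContD analytic_at_imp_isCont holomorphic_on_imp_analytic_at) auto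
  \<comment> \<open>In the right half-plane \<open>k\<close> may vanish where \<open>W\<close> does
    not, but there \<open>r\<close> agrees with \<open>W * f\<close>, which is regular; in
    \<open>S\<close> the limit of \<open>W / k\<close> is finite by the choice of \<open>W\<close>.
    So all singularities of \<open>r\<close> are removable.\<close>
  define r where "r = (\<lambda>s. W s / k s * g s)"
  have r_mero: "r meromorphic_on UNIV"
    unfolding r_def using W_hol k(2) g(2)
    by (intro meromorphic_intros analytic_on_imp_meromorphic_on) (auto simp: analytic_on_open)
  define a where "a = remove_sings r"
  have r_lim_right: "r \<midarrow>z\<rightarrow> W z * f z" if z: "Re z > 0" for z
  proof -
    have "eventually (\<lambda>s. W s * f s = r s) (at z)"
      using eventually_cosparse_imp_eventually_at[OF fgk, of z UNIV] by (auto elim: eventually_mono simp: r_def)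
    moreover have "(\<lambda>s. W s * f s) \<midarrow>z\<rightarrow> W z * f z"
      by (intro tendsto_mult at_lim W_hol isContD[OF analytic_at_imp_isCont[OF reg(1)[OF z]]])
    ultimately show ?thesis using tendsto_cong by force
  qed
  have "\<exists>c. r \<midarrow>z\<rightarrow> c" for z
  proof (cases "z \<in> S")
    case True
    then obtain c where "(\<lambda>s. W s / k s) \<midarrow>z\<rightarrow> c" using W(3) by blast
    from tendsto_mult[OF this at_lim[OF g(2), of z]] show ?thesis unfolding r_def by blast
  next
    case False
    thus ?thesis using r_lim_right[of z] by (auto simp: S_def)
  qed
  hence "a analytic_on {z}" for z
    unfolding a_def using r_mero remove_sings_analytic_at meromorphic_on_isolated_singularity
    by (metis UNIV_I meromorphic_on_altdef)
  hence a_hol: "a holomorphic_on UNIV"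
    by (metis analytic_imp_holomorphic analytic_on_analytic_at)
  have a_right: "a z = W z * f z" if "Re z > 0" for z
    unfolding a_def using r_lim_right[OF that] by (rule remove_sings_eqI)
  have "\<forall>\<^sub>\<approx>s. a s = r s" unfolding a_def by (rule eventually_remove_sings_eq[OF r_mero])
  hence a_cosparse: "\<forall>\<^sub>\<approx>s. a s * k s = W s * g s" "\<forall>\<^sub>\<approx>s. a s = W s * f s"
    using knz fgk by (eventually_elim, simp add: r_def)+
  \<comment> \<open>In this form finite order of \<open>a\<close> is an instance of the division
    theorem.\<close>
  have "a s * k s = W s * g s" for s
    by (rule cosparse_eq_imp_eq[OF a_cosparse(1)])
       (use a_hol k g W_hol in \<open>auto intro!: analytic_intros holomorphic_on_imp_analytic_at\<close>)
  hence "(\<lambda>s. a s * k s) = (\<lambda>s. W s * g s)" by auto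
  hence "entire_finite_order (\<lambda>s. a s * k s)" using entire_finite_order_mult[OF W(1) g(1)] by simp
  hence a_fo: "entire_finite_order a" by (rule entire_finite_order_quotient[OF a_hol k(1) p])
  define W' where "W' = (\<lambda>s. cnj (W (cnj s)))"
  have W': "entire_finite_order W'" unfolding W'_def by (rule entire_finite_order_cnj_conj[OF W(1)])
  have W'_nz: "W' s \<noteq> 0" if "Re s > 0" for s using W_nz[of "cnj s"] that by (simp add: W'_def)
  define b' where "b' = (\<lambda>s. W s * W' s)"
  define a' where "a' = (\<lambda>s. a s * W' s)"
  have fo: "entire_finite_order b'" "entire_finite_order a'"
    unfolding a'_def b'_def by (intro entire_finite_order_mult a_fo W W')+
  have b'_real: "cnj (b' (cnj s)) = b' s" for s by (simp add: b'_def W'_def)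
  have a'_right: "a' s = f s * b' s" if "Re s > 0" for s
    using a_right[OF that] by (simp add: a'_def b'_def)
  have a'_hol: "a' holomorphic_on UNIV" using fo by (simp add: entire_finite_order_def)
  \<comment> \<open>Reality comes from \<open>f\<close>, hence first on \<open>Re s > 0\<close>,
    where \<open>a' = f * b'\<close>, and then everywhere by analytic continuation.\<close>
  have a'_real: "cnj (a' (cnj s)) = a' s" for s
  proof (rule analytic_continuation_open[where f = "\<lambda>s. cnj (a' (cnj s))" and g = a' and s = "right_of 0" and s' = UNIV])
    show "right_of 0 \<noteq> {}" by (metis (mono_tags) empty_iff mem_Collect_eq one_complex.simps(1) zero_less_one)
    show "(\<lambda>s. cnj (a' (cnj s))) holomorphic_on UNIV" by (rule holomorphic_on_cnj_conj[OF a'_hol]) auto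
    show "cnj (a' (cnj z)) = a' z" if "z \<in> right_of 0" for z
      using a'_right[of z] a'_right[of "cnj z"] that f(4) b'_real[of z] by (simp add: real_analytic_fun_def)
  qed (use a'_hol open_right_of in auto)
  have nz: "b' s \<noteq> 0" "a' s \<noteq> 0" if "Re s > 0" for s
    using W_nz[OF that] W'_nz[OF that] reg(2)[OF that] a'_right[OF that] by (auto simp: b'_def)
  have eq1: "a' 1 = b' 1" using a'_right[of 1] f(5) by simp
  have "b' holomorphic_on UNIV" using fo by (simp add: entire_finite_order_def)
  hence b'_nz: "\<forall>\<^sub>\<approx>s. b' s \<noteq> 0" using entire_nonzero_cosparse[of b' 1] nz(1)[of 1] by simp
  have fo': "entire_finite_order (\<lambda>s. b' s * (1 / b' 1))" "entire_finite_order (\<lambda>s. a' s * (1 / b' 1))"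
    by (intro entire_finite_order_mult fo entire_finite_order_const)+
  \<comment> \<open>As \<open>f 1 = 1\<close>, both functions take the same real nonzero value at 1,
    so one constant normalises them without changing the quotient.\<close>
  show ?thesis
  proof (rule that[of "\<lambda>s. a' s * (1 / b' 1)" "\<lambda>s. b' s * (1 / b' 1)"])
    show "admissible (\<lambda>s. a' s * (1 / b' 1))"
      unfolding admissible_def real_analytic_fun_def
      using a'_real b'_real[of 1] nz nz[of 1] eq1 fo'(2) by auto
    show "admissible (\<lambda>s. b' s * (1 / b' 1))"
      unfolding admissible_def real_analytic_fun_def
      using b'_real b'_real[of 1] nz nz[of 1] fo'(1) by auto
    show "\<forall>\<^sub>\<approx>s. f s = a' s * (1 / b' 1) / (b' s * (1 / b' 1))"
      using a_cosparse(2) b'_nz by eventually_elim (use nz(1)[of 1] in \<open>simp add: a'_def b'_def field_simps\<close>)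
  qed
qed

section \<open>Construction of the family from admissible quotients\<close>

lemma remove_sings_cnj:
  assumes "\<And>s. cnj (h (cnj s)) = h s"
  shows "cnj (remove_sings h (cnj z)) = remove_sings h z"
proof -
  have tend: "h \<midarrow>cnj z\<rightarrow> cnj c" if "h \<midarrow>z\<rightarrow> c" for z c
  proof -
    have "cnj x \<noteq> z" if "x \<noteq> cnj z" for x using that by auto
    hence "filterlim cnj (at z) (at (cnj z))"
      by (auto simp: filterlim_at eventually_at_filter intro!: tendsto_eq_intros)
    from filterlim_compose[OF that this] have "(\<lambda>s. h (cnj s)) \<midarrow>cnj z\<rightarrow> c" .
    from tendsto_cnj[OF this] show ?thesis by (simp add: assms)
  qed
  show ?thesis
  proof (cases "\<exists>c. h \<midarrow>z\<rightarrow> c")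
    case True
    then obtain c where c: "h \<midarrow>z\<rightarrow> c" by blast
    from remove_sings_eqI[OF this] remove_sings_eqI[OF tend[OF this]] show ?thesis by simp
  next
    case False
    moreover have "\<not> (\<exists>c. h \<midarrow>cnj z\<rightarrow> c)" using False by (auto dest: tend[where z = "cnj z"])
    ultimately show ?thesis by (simp add: remove_sings_def)
  qed
qed

lemma admissible_quotient_properties:
  assumes a: "admissible a" and b: "admissible b"
  defines "\<Gamma> \<equiv> remove_sings (\<lambda>s. a s / b s)"
  shows "\<Gamma> nicely_meromorphic_on UNIV" "mero_finite_order \<Gamma>" "LLD \<Gamma>" "real_analytic_fun \<Gamma>" "\<Gamma> 1 = 1"
    and "\<And>s. b s \<noteq> 0 \<Longrightarrow> \<Gamma> s = a s / b s"
proof -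
  have hol: "a holomorphic_on UNIV" "b holomorphic_on UNIV" using a b by (auto intro: admissible_holomorphic)
  have ana: "(\<lambda>s. a s / b s) analytic_on {s}" if "b s \<noteq> 0" for s
    using that hol by (intro analytic_intros holomorphic_on_imp_analytic_at) auto
  show eq: "\<Gamma> s = a s / b s" if "b s \<noteq> 0" for s
    unfolding \<Gamma>_def by (rule remove_sings_at_analytic[OF ana[OF that]])
  have mero: "(\<lambda>s. a s / b s) meromorphic_on UNIV"
    using hol by (intro meromorphic_intros analytic_on_imp_meromorphic_on) (auto simp: analytic_on_open)
  show nice: "\<Gamma> nicely_meromorphic_on UNIV" unfolding \<Gamma>_def by (rule remove_sings_nicely_meromorphic[OF mero])
  have "\<forall>\<^sub>\<approx>s. \<Gamma> s = a s / b s"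
    using admissible_nonzero_cosparse[OF b] by eventually_elim (rule eq)
  moreover have "b 1 \<noteq> 0" using b by (simp add: admissible_def)
  moreover have "\<Gamma> meromorphic_on UNIV" using nice by (simp add: nicely_meromorphic_on_def)
  ultimately show "mero_finite_order \<Gamma>"
    using a b unfolding mero_finite_order_def admissible_def by blast
  show "\<Gamma> 1 = 1" using eq[of 1] a b by (simp add: admissible_def)
  show "LLD \<Gamma>"
    unfolding LLD_def
  proof (rule ballI, rule ccontr)
    fix s assume s: "s \<in> mero_zeros \<Gamma> \<union> mero_poles \<Gamma>" "\<not> Re s \<le> 0"
    hence nz: "a s \<noteq> 0" "b s \<noteq> 0" using a b by (auto simp: admissible_def)
    have "\<Gamma> analytic_on {s}" unfolding \<Gamma>_def by (rule remove_sings_analytic_on[OF ana[OF nz(2)]])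
    hence "\<Gamma> \<midarrow>s\<rightarrow> \<Gamma> s" "\<not> is_pole \<Gamma> s"
      by (auto intro: isContD analytic_at_imp_isCont dest: analytic_at_imp_no_pole)
    moreover from this s have "\<Gamma> \<midarrow>s\<rightarrow> 0" by (auto simp: mero_zeros_def mero_poles_def)
    ultimately have "\<Gamma> s = 0" using tendsto_unique by (metis trivial_limit_at)
    thus False using eq[OF nz(2)] nz by simp
  qed
  show "real_analytic_fun \<Gamma>"
    unfolding real_analytic_fun_def \<Gamma>_def
    by (intro allI remove_sings_cnj) (use a b in \<open>auto simp: admissible_def real_analytic_fun_def\<close>)
qed

lemma gamma_family_exists:
  assumes f: "f nicely_meromorphic_on UNIV" "mero_finite_order f" "LLD f" "real_analytic_fun f" "f 1 = 1"
  shows "\<exists>\<Gamma>. gamma_family f \<Gamma>"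
proof -
  obtain a b where ab: "admissible a" "admissible b" "\<forall>\<^sub>\<approx>s. f s = a s / b s"
    by (rule admissible_quotient[OF f])
  define step where "step = (\<lambda>h. SOME G. admissible G \<and> (\<forall>s. G s = h s * G (s + 1)))"
  have step: "admissible (step h)" "step h s = h s * step h (s + 1)" if "admissible h" for h s
    using someI_ex[OF exists_admissible_step[OF that]] unfolding step_def by blast+
  \<comment> \<open>As \<open>\<Gamma> 0\<close> is \<open>1 / f\<close>, the numerators start from
    the denominator \<open>b\<close> of \<open>f\<close>, and the denominators from
    \<open>a\<close>.\<close>
  define A where "A = (\<lambda>N. (step ^^ N) b)"
  define B where "B = (\<lambda>N. (step ^^ N) a)"
  have AB: "admissible (A N)" "admissible (B N)" for N
    unfolding A_def B_def by (induction N) (use ab step in auto)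
  have A_Suc: "A (Suc N) s = A N s * A (Suc N) (s + 1)" and B_Suc: "B (Suc N) s = B N s * B (Suc N) (s + 1)" for N s
    using step(2)[OF AB(1), of N s] step(2)[OF AB(2), of N s] by (simp_all add: A_def B_def)
  define \<Gamma> where "\<Gamma> = (\<lambda>N. remove_sings (\<lambda>s. A N s / B N s))"
  have props: "\<Gamma> N nicely_meromorphic_on UNIV" "mero_finite_order (\<Gamma> N)" "LLD (\<Gamma> N)"
      "real_analytic_fun (\<Gamma> N)" "\<Gamma> N 1 = 1" for N
    unfolding \<Gamma>_def using admissible_quotient_properties(1-5)[OF AB(1)[of N] AB(2)[of N]] by auto
  have \<Gamma>_eq: "\<Gamma> N s = A N s / B N s" if "B N s \<noteq> 0" for N s
    unfolding \<Gamma>_def by (rule admissible_quotient_properties(6)[OF AB(1)[of N] AB(2)[of N] that])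
  have nzA: "\<forall>\<^sub>\<approx>s. A N s \<noteq> 0" and nzB: "\<forall>\<^sub>\<approx>s. B N s \<noteq> 0" for N
    using AB by (auto intro: admissible_nonzero_cosparse)
  have rel: "\<forall>\<^sub>\<approx>s. \<Gamma> (Suc N) (s + 1) = inverse (\<Gamma> N s) * \<Gamma> (Suc N) s" for N
    using nzA[of N] nzB[of N] nzB[of "Suc N"]
  proof eventually_elim
    case (elim s)
    have nz: "B (Suc N) (s + 1) \<noteq> 0" using elim B_Suc[of N s] by auto
    show ?case
      using elim nz A_Suc[of N s] B_Suc[of N s] \<Gamma>_eq[of N s] \<Gamma>_eq[of "Suc N" s] \<Gamma>_eq[of "Suc N" "s + 1"]
      by simp
  qed
  have zero: "\<forall>\<^sub>\<approx>s. \<Gamma> 0 s = inverse (f s)"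
    using ab(3) nzB[of 0]
  proof eventually_elim
    case (elim s)
    thus ?case using \<Gamma>_eq[of 0 s] by (simp add: A_def B_def)
  qed
  have "gamma_family f \<Gamma>"
    unfolding gamma_family_def using zero rel props by blast
  thus ?thesis by blast
qed

section \<open>Uniqueness of the family and propagation of the cone\<close>

lemma gamma_family_unique:
  assumes f: "f nicely_meromorphic_on UNIV" and G: "gamma_family f \<Gamma>" "gamma_family f \<Gamma>'"
  shows "\<Gamma> = \<Gamma>'"
proof
  fix N show "\<Gamma> N = \<Gamma>' N"
  proof (induction N)
    case 0
    have "\<forall>\<^sub>\<approx>s. \<Gamma> 0 s = inverse (f s)" "\<forall>\<^sub>\<approx>s. \<Gamma>' 0 s = inverse (f s)"
      using G by (auto simp: gamma_family_def)
    hence "\<forall>\<^sub>\<approx>s. \<Gamma> 0 s = \<Gamma>' 0 s" by eventually_elim simp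
    thus ?case using G by (intro nicely_meromorphic_eqI) (auto simp: gamma_family_def)
  next
    case (Suc N)
    \<comment> \<open>The value 1 at 1 rules out the zero function, so \<open>\<Gamma> N\<close>
      takes the value 0 on a discrete set only and may serve as the coefficient.\<close>
    have "\<Gamma> N nicely_meromorphic_on UNIV" "\<Gamma> N 1 = 1" using G by (auto simp: gamma_family_def)
    with nicely_meromorphic_imp_constant_or_avoid[OF this(1) open_UNIV connected_UNIV, of 0]
    have nz: "\<forall>\<^sub>\<approx>s. \<Gamma> N s \<noteq> 0" by auto
    have eq1: "\<forall>\<^sub>\<approx>s. \<Gamma> (Suc N) (s + 1) = inverse (\<Gamma> N s) * \<Gamma> (Suc N) s"
      using G(1) by (simp add: gamma_family_def)
    have eq2: "\<forall>\<^sub>\<approx>s. \<Gamma>' (Suc N) (s + 1) = inverse (\<Gamma> N s) * \<Gamma>' (Suc N) s"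
      unfolding Suc.IH using G(2) by (simp add: gamma_family_def)
    show ?case
      by (rule difference_equation_unique[OF _ _ _ _ _ _ _ _ _ _ nz eq1 eq2])
         (use G in \<open>auto simp: gamma_family_def\<close>)
  qed
qed

text \<open>Zeros and poles are treated together: having a finite nonzero limit is stable under
  products, inverses and shifts, which is how the recursion acts.\<close>

lemma zero_or_pole_iff_no_nonzero_limit:
  assumes "g meromorphic_on UNIV"
  shows "s \<in> mero_zeros g \<union> mero_poles g \<longleftrightarrow> \<not> (\<exists>c. c \<noteq> 0 \<and> g \<midarrow>s\<rightarrow> c)"
proof -
  have pole: "\<not> is_pole g s" if "g \<midarrow>s\<rightarrow> c" for c
    using that not_tendsto_and_filterlim_at_infinity[of "at s" g c] by (auto simp: is_pole_def)
  have "not_essential g s" using assms by (auto simp: meromorphic_on_altdef)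
  then consider "is_pole g s" | c where "g \<midarrow>s\<rightarrow> c" by (auto simp: not_essential_def)
  thus ?thesis
  proof cases
    case 1
    thus ?thesis using pole by (auto simp: mero_poles_def)
  next
    case (2 c)
    have "g \<midarrow>s\<rightarrow> d \<longleftrightarrow> d = c" for d
      using 2 tendsto_unique[OF _ 2, of d] by auto
    thus ?thesis using pole[OF 2] by (auto simp: mero_zeros_def mero_poles_def)
  qed
qed

text \<open>A zero or pole \<open>s\<close> of \<open>\<Gamma> (Suc N)\<close> that is neither for \<open>\<Gamma> N\<close> would propagate to \<open>s + 1\<close>, hence
  eventually into \<open>Re s > 0\<close>; so it lies to the left of a zero or pole of \<open>\<Gamma> N\<close>.\<close>
lemma gamma_family_CLD:
  assumes f: "f nicely_meromorphic_on UNIV" "CLD f" and G: "gamma_family f \<Gamma>"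
  shows "CLD (\<Gamma> N)"
proof -
  obtain c where c: "c > 0" "\<And>s. s \<in> mero_zeros f \<union> mero_poles f \<Longrightarrow> c * \<bar>Im s\<bar> \<le> - Re s"
    using f(2) by (auto simp: CLD_def)
  have f_mero: "f meromorphic_on UNIV" using f(1) by (simp add: nicely_meromorphic_on_def)
  have mero: "\<Gamma> N meromorphic_on UNIV" for N using G by (auto simp: gamma_family_def nicely_meromorphic_on_def)
  note iff = zero_or_pole_iff_no_nonzero_limit[OF mero] and f_iff = zero_or_pole_iff_no_nonzero_limit[OF f_mero]
  have LLD: "LLD (\<Gamma> N)" for N using G by (auto simp: gamma_family_def)
  have "\<forall>s \<in> mero_zeros (\<Gamma> N) \<union> mero_poles (\<Gamma> N). c * \<bar>Im s\<bar> \<le> - Re s"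
  proof (induction N)
    case 0
    show ?case
    proof
      fix s assume s: "s \<in> mero_zeros (\<Gamma> 0) \<union> mero_poles (\<Gamma> 0)"
      have "s \<in> mero_zeros f \<union> mero_poles f"
        unfolding f_iff
      proof
        assume "\<exists>d. d \<noteq> 0 \<and> f \<midarrow>s\<rightarrow> d"
        then obtain d where d: "d \<noteq> 0" "f \<midarrow>s\<rightarrow> d" by blast
        have "\<forall>\<^sub>\<approx>s. \<Gamma> 0 s = inverse (f s)" using G by (simp add: gamma_family_def)
        from eventually_cosparse_imp_eventually_at[OF this, of s UNIV]
        have "eventually (\<lambda>s. \<Gamma> 0 s = inverse (f s)) (at s)" by simp
        hence "\<Gamma> 0 \<midarrow>s\<rightarrow> inverse d" using tendsto_inverse[OF d(2,1)] tendsto_cong by force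
        moreover have "inverse d \<noteq> 0" using d(1) by simp
        ultimately show False using s unfolding iff by blast
      qed
      thus "c * \<bar>Im s\<bar> \<le> - Re s" by (rule c(2))
    qed
  next
    case (Suc N)
    have rel: "\<forall>\<^sub>\<approx>s. \<Gamma> (Suc N) (s + 1) = inverse (\<Gamma> N s) * \<Gamma> (Suc N) s"
      using G by (simp add: gamma_family_def)
    have step: "s + 1 \<in> mero_zeros (\<Gamma> (Suc N)) \<union> mero_poles (\<Gamma> (Suc N))"
      if s: "s \<in> mero_zeros (\<Gamma> (Suc N)) \<union> mero_poles (\<Gamma> (Suc N))"
        "s \<notin> mero_zeros (\<Gamma> N) \<union> mero_poles (\<Gamma> N)" for s
      unfolding iff
    proof
      assume "\<exists>d. d \<noteq> 0 \<and> \<Gamma> (Suc N) \<midarrow>s + 1\<rightarrow> d"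
      then obtain d where d: "d \<noteq> 0" "\<Gamma> (Suc N) \<midarrow>s + 1\<rightarrow> d" by blast
      obtain e where e: "e \<noteq> 0" "\<Gamma> N \<midarrow>s\<rightarrow> e" using s(2) unfolding iff by blast
      have "(\<lambda>s. \<Gamma> (Suc N) (s + 1)) \<midarrow>s\<rightarrow> d" using LIM_offset[OF d(2), of 1] by simp
      from tendsto_mult[OF e(2) this] have lim: "(\<lambda>s. \<Gamma> N s * \<Gamma> (Suc N) (s + 1)) \<midarrow>s\<rightarrow> e * d" .
      have "eventually (\<lambda>s. \<Gamma> (Suc N) (s + 1) = inverse (\<Gamma> N s) * \<Gamma> (Suc N) s) (at s)"
        using eventually_cosparse_imp_eventually_at[OF rel, of s UNIV] by simp
      moreover have "eventually (\<lambda>s. \<Gamma> N s \<noteq> 0) (at s)"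
        using tendsto_imp_eventually_ne[OF e(2,1)] .
      ultimately have "eventually (\<lambda>s. \<Gamma> N s * \<Gamma> (Suc N) (s + 1) = \<Gamma> (Suc N) s) (at s)"
        by eventually_elim simp
      hence "\<Gamma> (Suc N) \<midarrow>s\<rightarrow> e * d" using lim tendsto_cong by force
      moreover have "e * d \<noteq> 0" using d(1) e(1) by simp
      ultimately show False using s(1) unfolding iff by blast
    qed
    show ?case
    proof
      fix s assume s: "s \<in> mero_zeros (\<Gamma> (Suc N)) \<union> mero_poles (\<Gamma> (Suc N))"
      have "\<exists>k. s + of_nat k \<in> mero_zeros (\<Gamma> N) \<union> mero_poles (\<Gamma> N)"
      proof (rule ccontr)
        assume neg: "\<not> ?thesis"
        have in_set: "s + of_nat k \<in> mero_zeros (\<Gamma> (Suc N)) \<union> mero_poles (\<Gamma> (Suc N))" for k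
        proof (induction k)
          case (Suc k)
          have "s + of_nat k + 1 \<in> mero_zeros (\<Gamma> (Suc N)) \<union> mero_poles (\<Gamma> (Suc N))"
            by (rule step[OF Suc.IH]) (use neg in blast)
          thus ?case by (simp only: of_nat_Suc add.assoc add.commute[of 1])
        qed (use s in simp)
        have "Re (s + of_nat (nat \<lceil>\<bar>Re s\<bar>\<rceil> + 1)) \<le> 0"
          using LLD[of "Suc N"] in_set[of "nat \<lceil>\<bar>Re s\<bar>\<rceil> + 1"] unfolding LLD_def by blast
        moreover have "Re s + real (nat \<lceil>\<bar>Re s\<bar>\<rceil> + 1) > 0" by linarith
        ultimately show False by simp
      qed
      then obtain k where "s + of_nat k \<in> mero_zeros (\<Gamma> N) \<union> mero_poles (\<Gamma> N)" by blast
      with Suc.IH have "c * \<bar>Im (s + of_nat k)\<bar> \<le> - Re (s + of_nat k)" by blast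
      \<comment> \<open>Going left by \<open>k\<close> keeps the imaginary part and increases
        \<open>- Re s\<close>, so the same cone works for every \<open>N\<close>.\<close>
      thus "c * \<bar>Im s\<bar> \<le> - Re s" by simp
    qed
  qed
  thus ?thesis using c(1) unfolding CLD_def by blast
qed

theorem theorem3p2:
  fixes f :: "complex \<Rightarrow> complex"
  assumes "f nicely_meromorphic_on UNIV"
    and "mero_finite_order f"
    and "real_analytic_fun f"
    and "LLD f"
    and "f 1 = 1"
  shows "(\<exists>!\<Gamma>. gamma_family f \<Gamma>) \<and>
         (CLD f \<longrightarrow> (\<forall>\<Gamma>. gamma_family f \<Gamma> \<longrightarrow> (\<forall>N. CLD (\<Gamma> N))))"
proof (intro conjI impI allI)
  obtain \<Gamma> where "gamma_family f \<Gamma>"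
    using gamma_family_exists[OF assms(1,2,4,3,5)] by blast
  thus "\<exists>!\<Gamma>. gamma_family f \<Gamma>"
    using gamma_family_unique[OF assms(1)] by blast
  show "CLD (\<Gamma> N)" if "CLD f" "gamma_family f \<Gamma>" for \<Gamma> N
    by (rule gamma_family_CLD[OF assms(1) that])
qed

end
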